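(* Assume that the policy is proper, that $\Phi_J$ has rank $l_J$ and $\Phi_M$ has rank $l_M$, and that $q(x)>0$ for all $x\in X$. Then the LSTD estimates satisfy $\hat w^*_J = A_N^{-1}b_N \to w^*_J$ and $\hat w^*_M = C_N^{-1}d_N\to w^*_M$ as $N\to\infty$, with probability 1.
   Context: Setting. $X=\{1,\dots,n\}$ is a finite state set and $x^*\notin X$ is an absorbing terminal state. A fixed policy induces a time-homogeneous Markov chain $(x_k)_{k\ge0}$ on $X\cup\{x^*\}$ with transition probabilities $P(y|x)$, $x\in X$, $y\in X\cup\{x^*\}$. The reward is a deterministic function $r:X\to\mathbb{R}$. The policy is proper if, from every initial state, there is positive probability that $x^*$ is reached after at most $n$ transitions. Let $\tau=\min\{k>0: x_k=x^*\}$. Let $P\in\mathbb{R}^{n\times n}$ be the matrix $P_{x,y}=P(y|x)$, $x,y\in X$ (the terminal state is excluded), let $r\in\mathbb{R}^n$ also denote the reward vector, and $R=\mathrm{diag}(r)$. Occupancy weights. The initial state $x_0$ is drawn from a fixed distribution $\zeta_0$ on $X$. Let $q_t(x)=\mathrm{Prob}(x_t=x)$, $q(x)=\sum_{t=0}^\infty q_t(x)$ for $x\in X$, $Q=\mathrm{diag}(q)$, and $\|y\|_q=\sqrt{\sum_{i=1}^n q(i)y(i)^2}$ for $y\in\mathbb{R}^n$. Features. $\phi_J(x)\in\mathbb{R}^{l_J}$ and $\phi_M(x)\in\mathbb{R}^{l_M}$, $x\in X$, are feature vectors; $\Phi_J\in\mathbb{R}^{n\times l_J}$, $\Phi_M\in\mathbb{R}^{n\times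 l_M}$ are the matrices with rows $\phi_J(x)^T$, $\phi_M(x)^T$. By convention $\phi_J(x^* )=0$ and $\phi_M(x^* )=0$. Let $S_J=\{\Phi_Jw:w\in\mathbb{R}^{l_J}\}$, $S_M=\{\Phi_Mw:w\in\mathbb{R}^{l_M}\}$, and let $\Pi_J,\Pi_M$ be the orthogonal projections of $\mathbb{R}^n$ onto $S_J,S_M$ with respect to $\|\cdot\|_q$. Target weights. Under the hypotheses of the claim there is a unique pair $(w^*_J,w^*_M)\in\mathbb{R}^{l_J}\times\mathbb{R}^{l_M}$ such that $$\Pi_J(r+P\Phi_Jw^*_J)=\Phi_Jw^*_J,\qquad \Pi_M(Rr+2RP\Phi_Jw^*_J+P\Phi_Mw^*_M)=\Phi_Mw^*_M.$$ LSTD estimates. Simulate independent trajectories $x^k_0,x^k_1,\dots,x^k_{\tau^k-1},x^k_{\tau^k}=x^*$, $k=1,2,\dots$, each distributed as the chain started from $\zeta_0$ and run until its terminal time $\tau^k$. For a function $f$ of a trajectory write $\mathbb{E}_N[f]=\frac1N\sum_{k=1}^N f(x^k,\tau^k)$, and set $$A_N=\mathbb{E}_N\Big[\sum_{t=0}^{\tau-1}\phi_J(x_t)(\phi_J(x_t)-\phi_J(x_{t+1}))^T\Big],\quad b_N=\mathbb{E}_N\Big[\sum_{t=0}^{\tau-1}\phi_J(x_t)r(x_t)\Big],$$ $$C_N=\mathbb{E}_N\Big[\sum_{t=0}^{\tau-1}\phi_M(x_t)(\phi_M(x_t)-\phi_M(x_{t+1}))^T\Big],\quad d_N=\mathbb{E}_N\Big[\sum_{t=0}^{\tau-1}\phi_M(x_t)r(x_t)\big(r(x_t)+2\phi_J(x_{t+1})^TA_N^{-1}b_N\big)\Big].$$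 For those $N$ for which $A_N$ or $C_N$ is singular, the corresponding inverse may be replaced by an arbitrary matrix; this does not affect the limiting statement. *)

theory Defs
  imports "HOL-Probability.Probability"
begin

text \<open>The state set is a finite type \<open>'n\<close>; a state of the chain is an element of \<open>'n option\<close>,
  with \<open>None\<close> the terminal state. Trajectories are infinite sequences of type
  \<open>nat \<Rightarrow> 'n option\<close> that stay in \<open>None\<close> once they have reached it.\<close>

definition step :: "('n \<Rightarrow> 'n option pmf) \<Rightarrow> 'n option \<Rightarrow> 'n option pmf" where
  "step K z = (case z of None \<Rightarrow> return_pmf None | Some x \<Rightarrow> K x)"

text \<open>Law of \<open>[x\<^sub>0, \<dots>, x\<^sub>t]\<close> when \<open>x\<^sub>0\<close> has law \<open>\<mu>\<close>.\<close>

primrec path_pmf :: "('n \<Rightarrow> 'n option pmf) \<Rightarrow> 'n option pmf \<Rightarrow> nat \<Rightarrow> 'n option list pmf" where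
  "path_pmf K \<mu> 0 = map_pmf (\<lambda>z. [z]) \<mu>"
| "path_pmf K \<mu> (Suc t) =
     bind_pmf (path_pmf K \<mu> t) (\<lambda>zs. map_pmf (\<lambda>z. zs @ [z]) (step K (last zs)))"

definition proper :: "('n::finite \<Rightarrow> 'n option pmf) \<Rightarrow> bool" where
  "proper K \<longleftrightarrow>
     (\<forall>x. measure_pmf.prob (path_pmf K (return_pmf (Some x)) CARD('n)) {zs. None \<in> set zs} > 0)"

definition trans_matrix :: "('n::finite \<Rightarrow> 'n option pmf) \<Rightarrow> real ^ 'n ^ 'n" where
  "trans_matrix K = (\<chi> x y. pmf (K x) (Some y))"

definition diag_matrix :: "real ^ 'n \<Rightarrow> real ^ 'n ^ 'n" where
  "diag_matrix v = (\<chi> i j. if i = j then v $ i else 0)"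

definition occupancy_at :: "('n \<Rightarrow> 'n option pmf) \<Rightarrow> 'n pmf \<Rightarrow> nat \<Rightarrow> 'n \<Rightarrow> real" where
  "occupancy_at K \<zeta>\<^sub>0 t x =
     measure_pmf.prob (path_pmf K (map_pmf Some \<zeta>\<^sub>0) t) {zs. zs ! t = Some x}"

definition occupancy :: "('n \<Rightarrow> 'n option pmf) \<Rightarrow> 'n pmf \<Rightarrow> 'n \<Rightarrow> real" where
  "occupancy K \<zeta>\<^sub>0 x = (\<Sum>t. occupancy_at K \<zeta>\<^sub>0 t x)"

text \<open>The inner product that induces the norm \<open>\<parallel>y\<parallel>\<^sub>q = sqrt (\<Sum>i. q i * (y i)\<^sup>2)\<close>. Orthogonal
  projections with respect to it are unique when \<open>q\<close> is positive.\<close>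

definition weighted_inner :: "('n::finite \<Rightarrow> real) \<Rightarrow> real ^ 'n \<Rightarrow> real ^ 'n \<Rightarrow> real" where
  "weighted_inner q y z = (\<Sum>i\<in>UNIV. q i * y $ i * z $ i)"

definition weighted_proj :: "('n::finite \<Rightarrow> real) \<Rightarrow> (real ^ 'n) set \<Rightarrow> real ^ 'n \<Rightarrow> real ^ 'n" where
  "weighted_proj q S y = (THE z. z \<in> S \<and> (\<forall>s\<in>S. weighted_inner q (y - z) s = 0))"

definition feature_space :: "real ^ 'l ^ 'n \<Rightarrow> (real ^ 'n) set" where
  "feature_space \<Phi> = range (\<lambda>w. \<Phi> *v w)"

definition is_target ::
  "('n::finite \<Rightarrow> 'n option pmf) \<Rightarrow> 'n pmf \<Rightarrow> real ^ 'n \<Rightarrow> real ^ 'j ^ 'n \<Rightarrow> real ^ 'm ^ 'n \<Rightarrow>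
   (real ^ 'j) \<times> (real ^ 'm) \<Rightarrow> bool" where
  "is_target K \<zeta>\<^sub>0 r \<Phi>\<^sub>J \<Phi>\<^sub>M = (\<lambda>(w\<^sub>J, w\<^sub>M).
     let q = occupancy K \<zeta>\<^sub>0; P = trans_matrix K; R = diag_matrix r in
       weighted_proj q (feature_space \<Phi>\<^sub>J) (r + P *v (\<Phi>\<^sub>J *v w\<^sub>J)) = \<Phi>\<^sub>J *v w\<^sub>J \<and>
       weighted_proj q (feature_space \<Phi>\<^sub>M)
         (R *v r + 2 *\<^sub>R (R *v (P *v (\<Phi>\<^sub>J *v w\<^sub>J))) + P *v (\<Phi>\<^sub>M *v w\<^sub>M)) = \<Phi>\<^sub>M *v w\<^sub>M)"

definition target_weights ::
  "('n::finite \<Rightarrow> 'n option pmf) \<Rightarrow> 'n pmf \<Rightarrow> real ^ 'n \<Rightarrow> real ^ 'j ^ 'n \<Rightarrow> real ^ 'm ^ 'n \<Rightarrow>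
   (real ^ 'j) \<times> (real ^ 'm)" where
  "target_weights K \<zeta>\<^sub>0 r \<Phi>\<^sub>J \<Phi>\<^sub>M = (THE p. is_target K \<zeta>\<^sub>0 r \<Phi>\<^sub>J \<Phi>\<^sub>M p)"

definition iid_trajectories ::
  "'w measure \<Rightarrow> ('n \<Rightarrow> 'n option pmf) \<Rightarrow> 'n pmf \<Rightarrow> (nat \<Rightarrow> 'w \<Rightarrow> nat \<Rightarrow> 'n option) \<Rightarrow> bool" where
  "iid_trajectories M K \<zeta>\<^sub>0 X \<longleftrightarrow>
     prob_space.indep_vars M (\<lambda>_. Pi\<^sub>M UNIV (\<lambda>_. count_space UNIV)) X UNIV \<and>
     (\<forall>k t. distr M (count_space UNIV) (\<lambda>\<omega>. map (X k \<omega>) [0..<Suc t]) =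
              measure_pmf (path_pmf K (map_pmf Some \<zeta>\<^sub>0) t))"

text \<open>\<open>Inf {} = 0\<close> on \<open>nat\<close>, so the hitting time of a trajectory that never terminates is 0;
  for a proper policy such trajectories form a null event.\<close>

definition hit_time :: "(nat \<Rightarrow> 'n option) \<Rightarrow> nat" where
  "hit_time x = Inf {k. 0 < k \<and> x k = None}"

definition feature :: "real ^ 'l ^ 'n \<Rightarrow> 'n option \<Rightarrow> real ^ 'l" where
  "feature \<Phi> z = (case z of None \<Rightarrow> 0 | Some x \<Rightarrow> \<Phi> $ x)"

definition reward :: "real ^ 'n \<Rightarrow> 'n option \<Rightarrow> real" where
  "reward r z = (case z of None \<Rightarrow> 0 | Some x \<Rightarrow> r $ x)"

definition outer :: "real ^ 'a \<Rightarrow> real ^ 'b \<Rightarrow> real ^ 'b ^ 'a" where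
  "outer u v = (\<chi> i j. u $ i * v $ j)"

definition sample_mean ::
  "((nat \<Rightarrow> 'n option) \<Rightarrow> 'v::real_vector) \<Rightarrow> (nat \<Rightarrow> nat \<Rightarrow> 'n option) \<Rightarrow> nat \<Rightarrow> 'v" where
  "sample_mean f xs N = (1 / real N) *\<^sub>R (\<Sum>k<N. f (xs k))"

text \<open>The matrices \<open>A\<^sub>N\<close> and \<open>C\<^sub>N\<close> are \<open>lstd_matrix \<Phi>\<^sub>J\<close> and \<open>lstd_matrix \<Phi>\<^sub>M\<close>. In \<open>lstd_d\<close>, the
  argument \<open>w\<close> is the estimate \<open>A\<^sub>N\<^sup>-\<^sup>1 b\<^sub>N\<close>.\<close>

definition lstd_matrix ::
  "real ^ 'l ^ 'n \<Rightarrow> (nat \<Rightarrow> nat \<Rightarrow> 'n option) \<Rightarrow> nat \<Rightarrow> real ^ 'l ^ 'l" where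
  "lstd_matrix \<Phi> = sample_mean (\<lambda>x. \<Sum>t<hit_time x.
     outer (feature \<Phi> (x t)) (feature \<Phi> (x t) - feature \<Phi> (x (Suc t))))"

definition lstd_b ::
  "real ^ 'n \<Rightarrow> real ^ 'j ^ 'n \<Rightarrow> (nat \<Rightarrow> nat \<Rightarrow> 'n option) \<Rightarrow> nat \<Rightarrow> real ^ 'j" where
  "lstd_b r \<Phi>\<^sub>J = sample_mean (\<lambda>x. \<Sum>t<hit_time x. reward r (x t) *\<^sub>R feature \<Phi>\<^sub>J (x t))"

definition lstd_d ::
  "real ^ 'n \<Rightarrow> real ^ 'j ^ 'n \<Rightarrow> real ^ 'm ^ 'n \<Rightarrow> real ^ 'j \<Rightarrow>
   (nat \<Rightarrow> nat \<Rightarrow> 'n option) \<Rightarrow> nat \<Rightarrow> real ^ 'm" where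
  "lstd_d r \<Phi>\<^sub>J \<Phi>\<^sub>M w = sample_mean (\<lambda>x. \<Sum>t<hit_time x.
     (reward r (x t) * (reward r (x t) + 2 * (feature \<Phi>\<^sub>J (x (Suc t)) \<bullet> w)))
       *\<^sub>R feature \<Phi>\<^sub>M (x t))"

text \<open>\<open>is_inverse_choice B A\<close>: \<open>B\<close> is the inverse of \<open>A\<close>, or any matrix if \<open>A\<close> is singular.\<close>

definition is_inverse_choice :: "real ^ 'l ^ 'l \<Rightarrow> real ^ 'l ^ 'l \<Rightarrow> bool" where
  "is_inverse_choice B A \<longleftrightarrow> (invertible A \<longrightarrow> B = matrix_inv A)"

end

theory Submission
  imports Defs
begin

text \<open>Sums of \<open>g (x t) (x (t + 1))\<close> along a trajectory up to its hitting time have finite fourth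
  moments, because a proper chain is still alive at time \<open>t\<close> with probability at most \<open>C * \<sigma> ^ t\<close>.
  The strong law of large numbers for independent variables with bounded fourth moments therefore
  identifies the limits of \<open>A\<^sub>N\<close>, \<open>b\<^sub>N\<close>, \<open>C\<^sub>N\<close> and of the two parts of \<open>d\<^sub>N\<close> (which is affine in the
  estimate \<open>w\<^sub>J\<close>). The limit of \<open>A\<^sub>N\<close> is \<open>\<Phi>\<^sup>T Q (I - P) \<Phi>\<close>, and the projected equations are the linear
  systems with these limits as coefficients. The balance equation \<open>q = \<zeta>\<^sub>0 + P\<^sup>T q\<close> gives, for
  \<open>y = \<Phi> v\<close> extended by \<open>0\<close> to the terminal state,
  \<open>2 y\<^sup>T Q (I - P) y = (\<Sum>x z. q x * P(z|x) * (y x - y z)\<^sup>2) + (\<Sum>x. \<zeta>\<^sub>0 x * (y x)\<^sup>2)\<close>.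
  If this vanishes, \<open>y\<close> is constant along every possible path, and since some path from each
  state is absorbed, \<open>y = 0\<close>. So the limit systems are uniquely solvable, and solutions of linear
  systems depend continuously on the coefficients near an invertible matrix.\<close>

subsection \<open>A strong law of large numbers\<close>

lemma abs_power_le_one_plus_power:
  fixes x :: real
  assumes "j \<le> n"
  shows "\<bar>x\<bar> ^ j \<le> 1 + \<bar>x\<bar> ^ n"
proof (cases "\<bar>x\<bar> \<le> 1")
  case True
  then have "\<bar>x\<bar> ^ j \<le> 1" by (simp add: power_le_one)
  then show ?thesis by (smt (verit) zero_le_power abs_ge_zero)
next
  case False
  then have "\<bar>x\<bar> ^ j \<le> \<bar>x\<bar> ^ n" using assms by (intro power_increasing) auto
  then show ?thesis by simp
qed

lemma (in finite_measure) integrable_lower_power: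
  fixes f :: "'a \<Rightarrow> real"
  assumes "f \<in> borel_measurable M" "integrable M (\<lambda>x. f x ^ n)" "j \<le> n"
  shows "integrable M (\<lambda>x. f x ^ j)"
proof (rule Bochner_Integration.integrable_bound)
  show "integrable M (\<lambda>x. 1 + \<bar>f x ^ n\<bar>)"
    using assms by (intro Bochner_Integration.integrable_add integrable_abs) auto
  show "AE x in M. norm (f x ^ j) \<le> norm (1 + \<bar>f x ^ n\<bar>)"
    using abs_power_le_one_plus_power[OF assms(3)] by (simp add: power_abs)
qed (use assms in measurable)

text \<open>Induction on \<open>n\<close>. The new term and the old partial sum are independent and
  centred, so every mixed term with a first power has mean 0. What remains of the mixed terms is six
  times a product of second moments, which is why the second moment bound is carried along in the
  induction.\<close>

lemma (in prob_space) moments_partial_sum: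
  fixes Z :: "nat \<Rightarrow> 'a \<Rightarrow> real"
  assumes indep: "indep_vars (\<lambda>_. borel) Z UNIV"
    and int: "\<And>k. integrable M (\<lambda>\<omega>. Z k \<omega> ^ 4)"
    and mean: "\<And>k. expectation (Z k) = 0"
    and m2: "\<And>k. expectation (\<lambda>\<omega>. Z k \<omega> ^ 2) \<le> D"
    and m4: "\<And>k. expectation (\<lambda>\<omega>. Z k \<omega> ^ 4) \<le> D"
    and D: "D \<ge> 1"
  shows "integrable M (\<lambda>\<omega>. (\<Sum>k<n. Z k \<omega>) ^ 4) \<and>
    expectation (\<lambda>\<omega>. (\<Sum>k<n. Z k \<omega>) ^ 2) \<le> real n * D \<and>
    expectation (\<lambda>\<omega>. (\<Sum>k<n. Z k \<omega>) ^ 4) \<le> 3 * (real n)\<^sup>2 * D\<^sup>2"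
proof (induction n)
  case 0
  then show ?case by simp
next
  case (Suc n)
  define S where "S = (\<lambda>\<omega>. \<Sum>k<n. Z k \<omega>)"
  have rv [measurable]: "random_variable borel (Z k)" for k
    using indep by (simp add: indep_vars_def)
  have rvS [measurable]: "random_variable borel S" unfolding S_def by measurable
  have "indep_vars (\<lambda>_. borel) Z (insert n {..<n})"
    using indep by (rule indep_vars_subset) simp
  then have ZS: "indep_var borel (Z n) borel S"
    unfolding S_def by (intro indep_vars_sum) auto
  have iZ: "integrable M (\<lambda>\<omega>. Z n \<omega> ^ i)" if "i \<le> 4" for i
    using integrable_lower_power[OF rv int that] .
  have iS: "integrable M (\<lambda>\<omega>. S \<omega> ^ i)" if "i \<le> 4" for i
    using integrable_lower_power[OF rvS _ that] Suc.IH by (simp add: S_def)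
  have ind: "indep_var borel (\<lambda>\<omega>. Z n \<omega> ^ i) borel (\<lambda>\<omega>. S \<omega> ^ j)" for i j
    using indep_var_compose[OF ZS, of "\<lambda>x. x ^ i" borel "\<lambda>x. x ^ j" borel]
    by (simp add: comp_def)
  have iP: "integrable M (\<lambda>\<omega>. Z n \<omega> ^ i * S \<omega> ^ j)"
    and eP: "expectation (\<lambda>\<omega>. Z n \<omega> ^ i * S \<omega> ^ j) =
      expectation (\<lambda>\<omega>. Z n \<omega> ^ i) * expectation (\<lambda>\<omega>. S \<omega> ^ j)"
    if "i \<le> 4" "j \<le> 4" for i j
    using indep_var_integrable[OF ind iZ iS] indep_var_lebesgue_integral[OF ind iZ iS] that by auto
  have sum: "(\<Sum>k<Suc n. Z k \<omega>) = Z n \<omega> + S \<omega>" for \<omega> by (simp add: S_def)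
  have exp2: "(Z n \<omega> + S \<omega>) ^ 2 = Z n \<omega> ^ 2 + 2 * (Z n \<omega> * S \<omega>) + S \<omega> ^ 2" for \<omega>
    by (simp add: power2_eq_square algebra_simps)
  have exp4: "(Z n \<omega> + S \<omega>) ^ 4 = Z n \<omega> ^ 4 + 4 * (Z n \<omega> ^ 3 * S \<omega> ^ 1) +
      6 * (Z n \<omega> ^ 2 * S \<omega> ^ 2) + 4 * (Z n \<omega> ^ 1 * S \<omega> ^ 3) + S \<omega> ^ 4" for \<omega>
    by (simp add: eval_nat_numeral algebra_simps)
  have mean1: "expectation (\<lambda>\<omega>. Z k \<omega> ^ 1) = 0" for k using mean by simp
  have meanS: "expectation (\<lambda>\<omega>. S \<omega> ^ 1) = 0"
  proof -
    have "integrable M (Z k)" for k using integrable_lower_power[OF rv int, of 1 k] by simp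
    then show ?thesis using mean by (simp add: S_def)
  qed
  have int4: "integrable M (\<lambda>\<omega>. (Z n \<omega> + S \<omega>) ^ 4)"
    unfolding exp4 by (intro Bochner_Integration.integrable_add integrable_mult_right iP iZ iS) auto
  have iP1: "integrable M (\<lambda>\<omega>. Z n \<omega> * S \<omega>)"
    and eP1: "expectation (\<lambda>\<omega>. Z n \<omega> * S \<omega>) = 0"
    using iP[of 1 1] eP[of 1 1] mean1[of n] by simp_all
  have E2: "expectation (\<lambda>\<omega>. (Z n \<omega> + S \<omega>) ^ 2) =
      expectation (\<lambda>\<omega>. Z n \<omega> ^ 2) + expectation (\<lambda>\<omega>. S \<omega> ^ 2)"
    unfolding exp2 using iZ[of 2] iS[of 2] iP1 eP1 by simp
  have E4: "expectation (\<lambda>\<omega>. (Z n \<omega> + S \<omega>) ^ 4) = expectation (\<lambda>\<omega>. Z n \<omega> ^ 4) +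
      6 * (expectation (\<lambda>\<omega>. Z n \<omega> ^ 2) * expectation (\<lambda>\<omega>. S \<omega> ^ 2)) + expectation (\<lambda>\<omega>. S \<omega> ^ 4)"
  proof -
    have "integrable M (\<lambda>\<omega>. Z n \<omega> ^ 3 * S \<omega>)" "integrable M (\<lambda>\<omega>. Z n \<omega> * S \<omega> ^ 3)"
      using iP[of 3 1] iP[of 1 3] by simp_all
    moreover have "expectation (\<lambda>\<omega>. Z n \<omega> ^ 3 * S \<omega>) = 0" "expectation (\<lambda>\<omega>. Z n \<omega> * S \<omega> ^ 3) = 0"
      using eP[of 3 1] eP[of 1 3] mean1[of n] meanS by simp_all
    ultimately show ?thesis
      unfolding exp4 using iZ[of 4] iS[of 4] iP[of 2 2] eP[of 2 2] by simp
  qed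
  have S2: "expectation (\<lambda>\<omega>. S \<omega> ^ 2) \<le> n * D" and S4: "expectation (\<lambda>\<omega>. S \<omega> ^ 4) \<le> 3 * (real n)\<^sup>2 * D\<^sup>2"
    using Suc.IH by (auto simp: S_def)
  have "expectation (\<lambda>\<omega>. Z n \<omega> ^ 2) * expectation (\<lambda>\<omega>. S \<omega> ^ 2) \<le> D * (n * D)"
    using m2 S2 D by (intro mult_mono) (auto intro: integral_nonneg_AE)
  \<comment> \<open>Enlarging the new fourth moment from \<open>D\<close> to
    \<open>3 * D\<^sup>2\<close> completes the square 3 n^2 + 6 n + 3 = 3 (n + 1)^2.\<close>
  moreover have "D \<le> 3 * D\<^sup>2" using D mult_left_mono[OF D, of D] by (simp add: power2_eq_square)
  ultimately have "expectation (\<lambda>\<omega>. (Z n \<omega> + S \<omega>) ^ 4) \<le> 3 * D\<^sup>2 + 6 * (D * (n * D)) + 3 * (real n)\<^sup>2 * D\<^sup>2"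
    unfolding E4 using m4[of n] S4 by linarith
  also have "\<dots> = 3 * (real (Suc n))\<^sup>2 * D\<^sup>2" by (simp add: power2_eq_square algebra_simps)
  finally show ?case
    unfolding sum using int4 E2 m2[of n] S2 by (simp add: algebra_simps)
qed

text \<open>The fourth powers of the averages of the centred variables have expectations of order 1
  / n^2. Their series therefore has finite expectation, converges almost surely, and its terms tend
  to 0.\<close>

theorem (in prob_space) strong_law_bounded_fourth_moments:
  fixes Y :: "nat \<Rightarrow> 'a \<Rightarrow> real"
  assumes indep: "indep_vars (\<lambda>_. borel) Y UNIV"
    and int: "\<And>k. integrable M (\<lambda>\<omega>. Y k \<omega> ^ 4)"
    and mean: "\<And>k. expectation (Y k) = m"
    and m4: "\<And>k. expectation (\<lambda>\<omega>. Y k \<omega> ^ 4) \<le> C"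
  shows "AE \<omega> in M. (\<lambda>N. (\<Sum>k<N. Y k \<omega>) / real N) \<longlonglongrightarrow> m"
proof -
  define Z where "Z = (\<lambda>k \<omega>. Y k \<omega> - m)"
  \<comment> \<open>The main part bounds the fourth moments of the centred variables through (a -
    b)^4 <= 8 a^4 + 8 b^4. The summand 1 lets \<open>D\<close> bound the second moments as well,
    through z^2 <= 1 + z^4, and makes \<open>D\<close> at least 1.\<close>
  define D where "D = 8 * (C + m ^ 4) + 1"
  have rvY [measurable]: "random_variable borel (Y k)" for k
    using indep by (simp add: indep_vars_def)
  have rvZ [measurable]: "random_variable borel (Z k)" for k unfolding Z_def by measurable
  have indepZ: "indep_vars (\<lambda>_. borel) Z UNIV"
    unfolding Z_def by (rule indep_vars_compose2[OF indep, where Y = "\<lambda>_ y. y - m"]) simp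
  have pow4: "(a - b) ^ 4 \<le> 8 * a ^ 4 + 8 * b ^ 4" for a b :: real
  proof -
    have "((a - b)\<^sup>2)\<^sup>2 \<le> (2 * (a\<^sup>2 + b\<^sup>2))\<^sup>2"
      using zero_le_power2[of "a + b"]
      by (intro power_mono zero_le_power2) (simp add: power2_eq_square algebra_simps)
    also have "\<dots> \<le> 8 * ((a\<^sup>2)\<^sup>2 + (b\<^sup>2)\<^sup>2)"
      using zero_le_power2[of "a\<^sup>2 - b\<^sup>2"] by (simp add: power2_eq_square algebra_simps)
    finally show ?thesis by simp
  qed
  have "integrable M (\<lambda>\<omega>. 8 * (Y k \<omega> ^ 4 + m ^ 4))" for k using int[of k] by simp
  then have intZ: "integrable M (\<lambda>\<omega>. Z k \<omega> ^ 4)" for k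
    by (rule Bochner_Integration.integrable_bound[of _ "\<lambda>\<omega>. 8 * (Y k \<omega> ^ 4 + m ^ 4)"])
       (simp_all add: Z_def pow4)
  have "expectation (\<lambda>\<omega>. Z k \<omega> ^ 4) \<le> expectation (\<lambda>\<omega>. 8 * (Y k \<omega> ^ 4 + m ^ 4))" for k
    using int[of k] intZ[of k] by (intro integral_mono) (simp_all add: Z_def pow4)
  also have "expectation (\<lambda>\<omega>. 8 * (Y k \<omega> ^ 4 + m ^ 4)) \<le> 8 * (C + m ^ 4)" for k
    using int[of k] m4[of k] by (simp add: prob_space)
  finally have Z4: "expectation (\<lambda>\<omega>. Z k \<omega> ^ 4) \<le> 8 * (C + m ^ 4)" for k .
  have C0: "0 \<le> expectation (\<lambda>\<omega>. Z k \<omega> ^ 4)" for k by (intro integral_nonneg_AE) auto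
  have D1: "D \<ge> 1" using order_trans[OF C0 Z4[of 0]] by (simp add: D_def)
  have iZ: "integrable M (\<lambda>\<omega>. Z k \<omega> ^ j)" if "j \<le> 4" for j k
    by (rule integrable_lower_power[OF rvZ intZ that])
  have "expectation (\<lambda>\<omega>. Z k \<omega> ^ 2) \<le> expectation (\<lambda>\<omega>. 1 + Z k \<omega> ^ 4)" for k
  proof (intro integral_mono)
    show "Z k \<omega> ^ 2 \<le> 1 + Z k \<omega> ^ 4" for \<omega>
      using abs_power_le_one_plus_power[of 2 4 "Z k \<omega>"] by simp
  qed (use iZ[of 2 k] intZ[of k] in simp_all)
  also have "expectation (\<lambda>\<omega>. 1 + Z k \<omega> ^ 4) \<le> D" for k
    using intZ[of k] Z4[of k] by (simp add: prob_space D_def)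
  finally have Z2: "expectation (\<lambda>\<omega>. Z k \<omega> ^ 2) \<le> D" for k .
  have iY: "integrable M (Y k)" for k using integrable_lower_power[OF rvY int, of 1 k] by simp
  have Z1: "expectation (Z k) = 0" for k using iY mean by (simp add: Z_def prob_space)
  have Z4': "expectation (\<lambda>\<omega>. Z k \<omega> ^ 4) \<le> D" for k using Z4[of k] by (simp add: D_def)
  note mom = moments_partial_sum[OF indepZ intZ Z1 Z2 Z4' D1]
  define T where "T = (\<lambda>n \<omega>. ((\<Sum>k<n. Z k \<omega>) / real n) ^ 4)"
  have T_meas [measurable]: "T n \<in> borel_measurable M" for n unfolding T_def by measurable
  have T_int: "integrable M (T n)" for n
    using mom[of n] by (simp add: T_def power_divide)
  \<comment> \<open>For \<open>n = 0\<close> both sides are 0, because division by zero yields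
    0.\<close>
  have T_E: "expectation (T n) \<le> 3 * D\<^sup>2 * (1 / (real n) ^ 2)" for n
  proof (cases "n = 0")
    case False
    have "expectation (T n) = expectation (\<lambda>\<omega>. (\<Sum>k<n. Z k \<omega>) ^ 4) / (real n) ^ 4"
      by (simp add: T_def power_divide)
    also have "\<dots> \<le> (3 * (real n)\<^sup>2 * D\<^sup>2) / (real n) ^ 4"
      using mom[of n] by (intro divide_right_mono) auto
    also have "\<dots> = 3 * D\<^sup>2 * (1 / (real n) ^ 2)"
      using False by (simp add: field_simps eval_nat_numeral)
    finally show ?thesis .
  qed (simp add: T_def)
  have T0: "T n \<omega> \<ge> 0" for n \<omega> by (simp add: T_def)
  have sumE: "summable (\<lambda>n. expectation (T n))"
  proof (rule summable_comparison_test')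
    show "summable (\<lambda>n. 3 * D\<^sup>2 * (1 / (real n) ^ 2))"
      using inverse_power_summable[of 2, where 'a = real] by (intro summable_mult) (simp add: inverse_eq_divide)
    show "norm (expectation (T n)) \<le> 3 * D\<^sup>2 * (1 / (real n) ^ 2)" if "n \<ge> 0" for n
      using T_E[of n] T0 by (simp add: integral_nonneg_AE)
  qed
  have "(\<integral>\<^sup>+\<omega>. (\<Sum>n. ennreal (T n \<omega>)) \<partial>M) = (\<Sum>n. \<integral>\<^sup>+\<omega>. ennreal (T n \<omega>) \<partial>M)"
    by (rule nn_integral_suminf) measurable
  also have "\<dots> = (\<Sum>n. ennreal (expectation (T n)))"
    by (intro suminf_cong nn_integral_eq_integral T_int) (use T0 in auto)
  also have "\<dots> = ennreal (\<Sum>n. expectation (T n))"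
    by (rule suminf_ennreal2) (use sumE T0 in \<open>auto intro!: integral_nonneg_AE\<close>)
  finally have "(\<integral>\<^sup>+\<omega>. (\<Sum>n. ennreal (T n \<omega>)) \<partial>M) \<noteq> \<infinity>" by simp
  then have "AE \<omega> in M. (\<Sum>n. ennreal (T n \<omega>)) \<noteq> \<infinity>"
    by (intro nn_integral_noteq_infinite) measurable
  then show ?thesis
  proof (rule AE_mp, intro AE_I2 impI)
    fix \<omega> assume "(\<Sum>n. ennreal (T n \<omega>)) \<noteq> \<infinity>"
    then have "summable (\<lambda>n. T n \<omega>)" using T0 by (intro summable_suminf_not_top) auto
    then have "(\<lambda>n. T n \<omega>) \<longlonglongrightarrow> 0" by (rule summable_LIMSEQ_zero)
    then have "(\<lambda>n. root 4 (T n \<omega>)) \<longlonglongrightarrow> root 4 0" by (intro tendsto_intros)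
    moreover have "root 4 (T n \<omega>) = \<bar>(\<Sum>k<n. Z k \<omega>) / real n\<bar>" for n
    proof -
      have "T n \<omega> = \<bar>(\<Sum>k<n. Z k \<omega>) / real n\<bar> ^ 4"
        by (simp add: T_def power_even_abs_numeral del: abs_divide)
      then show ?thesis by (simp only: real_root_power_cancel abs_ge_zero zero_less_numeral)
    qed
    ultimately have "(\<lambda>n. (\<Sum>k<n. Z k \<omega>) / real n) \<longlonglongrightarrow> 0"
      by (simp add: tendsto_rabs_zero_iff del: abs_divide)
    then have "(\<lambda>n. (\<Sum>k<n. Z k \<omega>) / real n + m) \<longlonglongrightarrow> 0 + m" by (intro tendsto_intros)
    \<comment> \<open>At \<open>n = 0\<close> the left side is \<open>m\<close> and the right side
      is 0, so the identity holds only eventually.\<close>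
    moreover have "\<forall>\<^sub>F n in sequentially. (\<Sum>k<n. Z k \<omega>) / real n + m = (\<Sum>k<n. Y k \<omega>) / real n"
      using eventually_gt_at_top[of 0]
      by eventually_elim (simp add: Z_def sum_subtractf field_simps)
    ultimately show "(\<lambda>N. (\<Sum>k<N. Y k \<omega>) / real N) \<longlonglongrightarrow> m"
      by (simp add: tendsto_cong)
  qed
qed

subsection \<open>Linear systems and weighted projections\<close>

text \<open>A kernel vector annihilates the quadratic form, so the kernel is trivial. This serves
  both the Gram matrix of the features and the limit matrix of the estimates.\<close>

lemma invertibleI_definite:
  fixes A :: "real ^ 'l ^ 'l"
  assumes "\<And>v. v \<bullet> (A *v v) = 0 \<Longrightarrow> v = 0"
  shows "invertible A"
proof -
  have "\<forall>v. A *v v = 0 \<longrightarrow> v = 0" using assms by (metis inner_zero_right)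
  then show ?thesis by (simp add: invertible_left_inverse matrix_left_invertible_ker)
qed

lemma mult_matrix_inv_vector_eq_iff:
  fixes A :: "real ^ 'l ^ 'l"
  assumes "invertible A"
  shows "A *v x = b \<longleftrightarrow> x = matrix_inv A *v b"
proof -
  have "A ** matrix_inv A = mat 1 \<and> matrix_inv A ** A = mat 1"
    using assms unfolding invertible_def matrix_inv_def by (rule someI_ex)
  then show ?thesis by (metis matrix_vector_mul_assoc matrix_vector_mul_lid)
qed

lemma tendsto_det:
  fixes A :: "'a \<Rightarrow> real ^ 'l ^ 'l"
  assumes "(A \<longlongrightarrow> A0) F"
  shows "((\<lambda>n. det (A n)) \<longlongrightarrow> det A0) F"
  unfolding det_def by (intro tendsto_intros assms)

lemma tendsto_vec_lambda2:
  fixes f :: "'a \<Rightarrow> 'i::finite \<Rightarrow> 'k::finite \<Rightarrow> real"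
  assumes "\<And>i j. ((\<lambda>n. f n i j) \<longlongrightarrow> g i j) F"
  shows "((\<lambda>n. \<chi> i j. f n i j) \<longlongrightarrow> (\<chi> i j. g i j)) F"
  by (intro vec_tendstoI) (simp add: assms)

text \<open>Cramer's rule supplies the continuity of matrix inversion.\<close>

lemma tendsto_inverse_choice_mult:
  fixes A B :: "nat \<Rightarrow> real ^ 'l ^ 'l"
  assumes A: "A \<longlonglongrightarrow> A0" and b: "b \<longlonglongrightarrow> b0" and inv: "invertible A0"
    and B: "\<And>n. is_inverse_choice (B n) (A n)"
  shows "(\<lambda>n. B n *v b n) \<longlonglongrightarrow> matrix_inv A0 *v b0"
proof -
  define sol where "sol = (\<lambda>(C :: real ^ 'l ^ 'l) (c :: real ^ 'l).
    (\<chi> k. det (\<chi> i j. if j = k then c $ i else C $ i $ j) / det C) :: real ^ 'l)"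
  have sol: "sol C c = matrix_inv C *v c" if "det C \<noteq> 0" for C c
    using cramer[OF that, of "matrix_inv C *v c" c] that
    by (simp add: sol_def mult_matrix_inv_vector_eq_iff invertible_det_nz)
  have d0: "det A0 \<noteq> 0" using inv by (simp add: invertible_det_nz)
  have "((\<lambda>n. if j = k then b n $ i else A n $ i $ j) \<longlongrightarrow>
      (if j = k then b0 $ i else A0 $ i $ j)) sequentially" for i j k
    by (cases "j = k") (auto intro!: tendsto_intros A b)
  then have "(\<lambda>n. sol (A n) (b n)) \<longlonglongrightarrow> sol A0 b0"
    unfolding sol_def using d0
    by (intro vec_tendstoI) (auto intro!: tendsto_divide tendsto_det tendsto_vec_lambda2 A)
  \<comment> \<open>The determinants tend to a nonzero number, so all but finitely many
    \<open>A n\<close> are invertible, and there the chosen matrix is the true inverse.\<close>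
  moreover have "\<forall>\<^sub>F n in sequentially. sol (A n) (b n) = B n *v b n"
    using tendsto_imp_eventually_ne[OF tendsto_det[OF A] d0]
    by eventually_elim (use B sol in \<open>auto simp: is_inverse_choice_def invertible_det_nz\<close>)
  ultimately show ?thesis by (simp add: sol[OF d0] tendsto_cong)
qed

lemma tendsto_matrix_vector_mult:
  fixes A :: "'a \<Rightarrow> real ^ 'l ^ 'k"
  assumes "(A \<longlongrightarrow> A0) F" "(v \<longlongrightarrow> v0) F"
  shows "((\<lambda>n. A n *v v n) \<longlongrightarrow> A0 *v v0) F"
  by (intro vec_tendstoI) (auto simp: matrix_vector_mult_def intro!: tendsto_intros assms)

lemma weighted_inner_diff:
  "weighted_inner q (y - y') z = weighted_inner q y z - weighted_inner q y' z"
  by (simp add: weighted_inner_def algebra_simps sum_subtractf)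

lemma weighted_inner_self_eq_0:
  assumes "\<And>x. q x > 0" "weighted_inner q y y = 0"
  shows "y = 0"
proof -
  have "\<forall>x\<in>UNIV. q x * y $ x * y $ x = 0"
    using assms by (subst sum_nonneg_eq_0_iff[symmetric])
      (auto simp: weighted_inner_def mult.assoc less_imp_le)
  then show ?thesis using assms(1) by (auto simp: vec_eq_iff) (metis less_irrefl)
qed

text \<open>The definite description in \<open>weighted_proj\<close> carries information only once
  the projection exists and is unique. Existence comes from the normal equations, whose Gram matrix
  is invertible by positivity of \<open>q\<close> and injectivity of \<Phi>. Uniqueness holds
  because the difference of two candidates lies in the space and is orthogonal to itself.\<close>

lemma weighted_proj_eq_iff:
  assumes q: "\<And>x. q x > 0" and inj: "inj ((*v) \<Phi>)"
  shows "weighted_proj q (feature_space \<Phi>) y = \<Phi> *v w \<longleftrightarrow>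
    (\<forall>v. weighted_inner q (y - \<Phi> *v w) (\<Phi> *v v) = 0)"
proof -
  let ?P = "\<lambda>z. z \<in> feature_space \<Phi> \<and> (\<forall>s\<in>feature_space \<Phi>. weighted_inner q (y - z) s = 0)"
  define D where "D = diag_matrix (\<chi> x. q x)"
  \<comment> \<open>Rewritten with the Euclidean inner product, orthogonality to the feature space
    becomes a linear system with matrix \<open>transpose \<Phi> ** D ** \<Phi>\<close>.\<close>
  have D: "weighted_inner q u (\<Phi> *v v) = v \<bullet> (transpose \<Phi> *v (D *v u))" for u v
    by (simp add: weighted_inner_def D_def diag_matrix_def inner_vec_def matrix_vector_mult_def
        transpose_def sum_distrib_left sum_distrib_right if_distrib[of "\<lambda>x. x * _"] cong: if_cong)
       (subst sum.swap, simp add: mult_ac)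
  have "invertible (transpose \<Phi> ** D ** \<Phi>)"
  proof (rule invertibleI_definite)
    fix v assume "v \<bullet> ((transpose \<Phi> ** D ** \<Phi>) *v v) = 0"
    then have "weighted_inner q (\<Phi> *v v) (\<Phi> *v v) = 0"
      unfolding D by (simp add: matrix_vector_mul_assoc matrix_mul_assoc)
    then have "\<Phi> *v v = \<Phi> *v 0" using weighted_inner_self_eq_0[OF q] by simp
    then show "v = 0" using inj by (rule injD[rotated])
  qed
  then obtain w0 where "(transpose \<Phi> ** D ** \<Phi>) *v w0 = transpose \<Phi> *v (D *v y)"
    using mult_matrix_inv_vector_eq_iff by blast
  then have "weighted_inner q (y - \<Phi> *v w0) (\<Phi> *v v) = 0" for v
    by (simp add: D weighted_inner_diff matrix_vector_mul_assoc matrix_mul_assoc)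
  then have ex: "?P (\<Phi> *v w0)" by (auto simp: feature_space_def)
  have uniq: "z = z'" if "?P z" "?P z'" for z z'
  proof -
    have "z - z' \<in> feature_space \<Phi>"
      using that by (auto simp: feature_space_def simp flip: matrix_vector_mult_diff_distrib)
    then have "weighted_inner q (y - z') (z - z') - weighted_inner q (y - z) (z - z') = 0"
      using that by simp
    then have "weighted_inner q (z - z') (z - z') = 0" by (simp add: weighted_inner_diff)
    then show ?thesis using weighted_inner_self_eq_0[OF q] by fastforce
  qed
  have "?P (weighted_proj q (feature_space \<Phi>) y)"
    unfolding weighted_proj_def by (rule theI[where P = ?P, OF ex uniq[OF _ ex]])
  then have "weighted_proj q (feature_space \<Phi>) y = z \<longleftrightarrow> ?P z" for z
    using uniq by blast
  then show ?thesis by (auto simp: feature_space_def)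
qed

subsection \<open>Laws of the absorbed chain\<close>

text \<open>The marginal law at time \<open>t\<close>. Reading it off with \<open>last\<close> lets
  the recursion of \<open>path_pmf\<close> pass directly to states.\<close>

definition state_pmf :: "('n \<Rightarrow> 'n option pmf) \<Rightarrow> 'n option pmf \<Rightarrow> nat \<Rightarrow> 'n option pmf" where
  "state_pmf K \<mu> t = map_pmf last (path_pmf K \<mu> t)"

lemma length_path_pmf: "zs \<in> set_pmf (path_pmf K \<mu> t) \<Longrightarrow> length zs = Suc t"
  by (induction t arbitrary: zs) auto

lemma last_path_pmf: "zs \<in> set_pmf (path_pmf K \<mu> t) \<Longrightarrow> last zs = zs ! t"
  using length_path_pmf[of zs K \<mu> t] by (subst last_conv_nth) auto

lemma state_pmf_0 [simp]: "state_pmf K \<mu> 0 = \<mu>"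
  by (simp add: state_pmf_def map_pmf_comp)

lemma state_pmf_Suc: "state_pmf K \<mu> (Suc t) = bind_pmf (state_pmf K \<mu> t) (step K)"
  by (simp add: state_pmf_def map_bind_pmf map_pmf_comp bind_map_pmf)

text \<open>The Chapman-Kolmogorov equation; it allows survival to be estimated in blocks of
  steps.\<close>

lemma state_pmf_add:
  "state_pmf K \<mu> (s + t) = bind_pmf (state_pmf K \<mu> s) (\<lambda>z. state_pmf K (return_pmf z) t)"
  by (induction t) (simp_all add: state_pmf_Suc bind_return_pmf' bind_assoc_pmf)

lemma state_pmf_None: "state_pmf K (return_pmf None) t = return_pmf None"
  by (induction t) (simp_all add: state_pmf_Suc bind_return_pmf step_def)

text \<open>Each summand along a trajectory involves two consecutive states, so this joint law is
  all that its mean requires.\<close>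

lemma transition_pmf_path:
  "map_pmf (\<lambda>zs. (zs ! t, zs ! Suc t)) (path_pmf K \<mu> (Suc t)) =
    bind_pmf (state_pmf K \<mu> t) (\<lambda>z. map_pmf (Pair z) (step K z))"
  unfolding state_pmf_def path_pmf.simps map_bind_pmf bind_map_pmf map_pmf_comp
proof (intro bind_pmf_cong map_pmf_cong refl)
  fix zs z assume "zs \<in> set_pmf (path_pmf K \<mu> t)"
  then show "((zs @ [z]) ! t, (zs @ [z]) ! Suc t) = (last zs, z)"
    using length_path_pmf[of zs K \<mu> t] last_path_pmf[of zs K \<mu> t]
    by (simp add: nth_append)
qed

lemma occupancy_at_eq: "occupancy_at K \<zeta> t x = pmf (state_pmf K (map_pmf Some \<zeta>) t) (Some x)"
  unfolding occupancy_at_def state_pmf_def pmf_map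
  by (intro measure_pmf.finite_measure_eq_AE) (auto simp: AE_measure_pmf_iff last_path_pmf)

text \<open>Links \<open>proper\<close>, which speaks of a visit to the terminal state at any time
  up to n, with the marginal law at time n.\<close>

lemma path_pmf_absorbed:
  "zs \<in> set_pmf (path_pmf K \<mu> t) \<Longrightarrow> None \<in> set zs \<Longrightarrow> last zs = None"
proof (induction t arbitrary: zs)
  case (Suc t)
  then obtain ys z where "ys \<in> set_pmf (path_pmf K \<mu> t)" "zs = ys @ [z]" "z \<in> set_pmf (step K (last ys))"
    by auto
  with Suc show ?case by (auto simp: step_def)
qed auto

lemma pmf_bind_finite:
  fixes p :: "'a::finite pmf"
  shows "pmf (bind_pmf p f) i = (\<Sum>z\<in>UNIV. pmf p z * pmf (f z) i)"
  unfolding pmf_bind by (subst integral_measure_pmf[of UNIV]) auto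

lemma sum_option_UNIV:
  fixes f :: "'n::finite option \<Rightarrow> 'v::comm_monoid_add"
  shows "(\<Sum>z\<in>UNIV. f z) = f None + (\<Sum>x\<in>UNIV. f (Some x))"
  by (simp add: UNIV_option_conv sum.reindex)

section \<open>Survival probabilities and occupancy weights\<close>

definition alive :: "('n \<Rightarrow> 'n option pmf) \<Rightarrow> 'n option pmf \<Rightarrow> nat \<Rightarrow> real" where
  "alive K \<mu> t = 1 - pmf (state_pmf K \<mu> t) None"

lemma alive_nonneg: "0 \<le> alive K \<mu> t" and alive_le_1: "alive K \<mu> t \<le> 1"
  by (simp_all add: alive_def pmf_le_1)

lemma alive_eq_sum:
  fixes K :: "'n::finite \<Rightarrow> 'n option pmf"
  shows "alive K \<mu> t = (\<Sum>x\<in>UNIV. pmf (state_pmf K \<mu> t) (Some x))"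
  using sum_pmf_eq_1[of UNIV "state_pmf K \<mu> t"] by (simp add: alive_def sum_option_UNIV)

lemma alive_add:
  fixes K :: "'n::finite \<Rightarrow> 'n option pmf"
  shows "alive K \<mu> (s + t) =
    (\<Sum>x\<in>UNIV. pmf (state_pmf K \<mu> s) (Some x) * alive K (return_pmf (Some x)) t)"
proof -
  have "alive K \<mu> (s + t) = (\<Sum>z\<in>UNIV. pmf (state_pmf K \<mu> s) z) -
      (\<Sum>z\<in>UNIV. pmf (state_pmf K \<mu> s) z * pmf (state_pmf K (return_pmf z) t) None)"
    by (simp add: alive_def state_pmf_add pmf_bind_finite sum_pmf_eq_1)
  also have "\<dots> = (\<Sum>z\<in>UNIV. pmf (state_pmf K \<mu> s) z * alive K (return_pmf z) t)"
    by (simp add: alive_def algebra_simps sum_subtractf)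
  finally show ?thesis by (simp add: sum_option_UNIV alive_def[of K "return_pmf None"] state_pmf_None)
qed

lemma alive_add_le:
  fixes K :: "'n::finite \<Rightarrow> 'n option pmf"
  assumes "\<And>x. alive K (return_pmf (Some x)) t \<le> \<rho>"
  shows "alive K \<mu> (s + t) \<le> \<rho> * alive K \<mu> s"
  unfolding alive_add alive_eq_sum[of K \<mu> s] sum_distrib_left
  using assms by (intro sum_mono) (simp add: mult.commute mult_right_mono)

lemma proper_alive_less_1:
  fixes K :: "'n::finite \<Rightarrow> 'n option pmf"
  assumes "proper K"
  shows "alive K (return_pmf (Some x)) CARD('n) < 1"
proof -
  let ?p = "path_pmf K (return_pmf (Some x)) CARD('n)"
  have "0 < measure_pmf.prob ?p {zs. None \<in> set zs}" using assms by (simp add: proper_def)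
  also have "\<dots> \<le> measure_pmf.prob ?p (last -` {None})"
    by (intro measure_pmf.finite_measure_mono_AE) (auto simp: AE_measure_pmf_iff path_pmf_absorbed)
  finally show ?thesis by (simp add: alive_def state_pmf_def pmf_map)
qed

text \<open>There are finitely many starting states, so the largest probability \<rho> of surviving
  n steps is below 1. Every further block of n steps multiplies the survival probability by at most
  \<rho>, and the rate per step is the n-th root of \<rho>.\<close>

lemma alive_geometric:
  fixes K :: "'n::finite \<Rightarrow> 'n option pmf"
  assumes "proper K"
  obtains C \<sigma> where "0 < \<sigma>" "\<sigma> < 1" "\<And>t. alive K \<mu> t \<le> C * \<sigma> ^ t"
proof -
  define n where "n = CARD('n)"
  have n: "n > 0" by (simp add: n_def)
  \<comment> \<open>The maximum with 1/2 keeps \<rho> positive even if absorption within n steps is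
    certain; \<rho> is divided by below.\<close>
  define \<rho> where "\<rho> = max (1/2) (Max (range (\<lambda>x. alive K (return_pmf (Some x)) n)))"
  have \<rho>: "0 < \<rho>" "\<rho> < 1"
    using proper_alive_less_1[OF assms] by (simp_all add: \<rho>_def n_def)
  have "alive K (return_pmf (Some x)) n \<le> \<rho>" for x
    by (simp add: \<rho>_def le_max_iff_disj)
  then have dec: "alive K \<mu> (s + n) \<le> \<rho> * alive K \<mu> s" for s by (rule alive_add_le)
  have block: "alive K \<mu> (j + k * n) \<le> \<rho> ^ k" for j k
  proof (induction k)
    case (Suc k)
    have "alive K \<mu> (j + k * n + n) \<le> \<rho> * \<rho> ^ k"
      using dec[of "j + k * n"] mult_left_mono[OF Suc, of \<rho>] \<rho> by linarith
    then show ?case by (simp add: algebra_simps)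
  qed (simp add: alive_le_1)
  define \<sigma> where "\<sigma> = root n \<rho>"
  have \<sigma>: "0 < \<sigma>" "\<sigma> < 1" "\<sigma> ^ n = \<rho>"
    using \<rho> n by (simp_all add: \<sigma>_def)
  \<comment> \<open>The factor \<open>1 / \<rho>\<close> pays for the last, incomplete
    block.\<close>
  have "alive K \<mu> t \<le> (1 / \<rho>) * \<sigma> ^ t" for t
  proof -
    have "t \<le> n * (t div n) + n"
      using n by (metis add_left_mono less_imp_le mod_less_divisor mult_div_mod_eq)
    then have "\<sigma> ^ (n * (t div n) + n) \<le> \<sigma> ^ t" using \<sigma> by (intro power_decreasing) auto
    then have "\<rho> ^ (t div n) * \<rho> \<le> \<sigma> ^ t" by (simp add: power_add power_mult \<sigma>)
    moreover have "alive K \<mu> t \<le> \<rho> ^ (t div n)" using block[of "t mod n" "t div n"] by simp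
    ultimately show ?thesis using \<rho> by (simp add: field_simps) (meson mult_left_mono less_imp_le order_trans)
  qed
  with \<sigma> that show ?thesis by blast
qed

text \<open>Write \<sigma> as the (p + 1)-st power of s. Then p of the factors s^t keep the
  polynomial bounded, since (t + 1) s^t is bounded, and the remaining factor is a convergent
  geometric series.\<close>

lemma summable_poly_times_geometric:
  fixes \<sigma> :: real
  assumes "0 < \<sigma>" "\<sigma> < 1"
  shows "summable (\<lambda>t. real (Suc t) ^ p * \<sigma> ^ t)"
proof -
  define s where "s = root (Suc p) \<sigma>"
  have s: "0 < s" "s < 1" "s ^ Suc p = \<sigma>" using assms by (simp_all add: s_def del: power_Suc)
  have "(\<lambda>t. real t * s ^ t + s ^ t) \<longlonglongrightarrow> 0 + 0"
    using s by (intro tendsto_add powser_times_n_limit_0 LIMSEQ_realpow_zero) auto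
  then have "Bseq (\<lambda>t. real t * s ^ t + s ^ t)" by (rule convergent_imp_Bseq[OF convergentI])
  then obtain B where B: "\<And>t. \<bar>real t * s ^ t + s ^ t\<bar> \<le> B" by (auto simp: Bseq_def)
  have le: "real (Suc t) ^ p * \<sigma> ^ t \<le> B ^ p * s ^ t" for t
  proof -
    have "real (Suc t) ^ p * \<sigma> ^ t = (real (Suc t) * s ^ t) ^ p * s ^ t"
    proof -
      have "\<sigma> ^ t = (s ^ t) ^ p * s ^ t"
        unfolding s(3)[symmetric]
        by (simp only: power_mult[symmetric] power_add[symmetric] mult_Suc mult_Suc_right mult.commute add.commute)
      then show ?thesis by (simp add: power_mult_distrib)
    qed
    also have "\<dots> \<le> B ^ p * s ^ t"
      using B[of t] s by (intro mult_right_mono power_mono) (auto simp: algebra_simps)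
    finally show ?thesis .
  qed
  show ?thesis
  proof (rule summable_comparison_test')
    show "summable (\<lambda>t. B ^ p * s ^ t)"
      using s by (intro summable_mult summable_geometric) simp
    show "norm (real (Suc t) ^ p * \<sigma> ^ t) \<le> B ^ p * s ^ t" if "t \<ge> 0" for t
      using le[of t] assms by (simp only: real_norm_def abs_of_nonneg mult_nonneg_nonneg
          zero_le_power of_nat_0_le_iff less_imp_le)
  qed
qed

text \<open>The case \<open>p = 0\<close> gives convergence of the occupancy series and absorption
  by Borel-Cantelli; the case \<open>p = 4\<close> bounds the fourth moments for the strong
  law.\<close>

lemma summable_alive:
  fixes K :: "'n::finite \<Rightarrow> 'n option pmf"
  assumes "proper K"
  shows "summable (\<lambda>t. real (Suc t) ^ p * alive K \<mu> t)"
proof -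
  obtain C \<sigma> where C: "0 < \<sigma>" "\<sigma> < 1" "\<And>t. alive K \<mu> t \<le> C * \<sigma> ^ t"
    using alive_geometric[OF assms] by blast
  show ?thesis
  proof (rule summable_comparison_test')
    show "summable (\<lambda>t. C * (real (Suc t) ^ p * \<sigma> ^ t))"
      by (intro summable_mult summable_poly_times_geometric C)
    show "norm (real (Suc t) ^ p * alive K \<mu> t) \<le> C * (real (Suc t) ^ p * \<sigma> ^ t)" for t
      using mult_left_mono[OF C(3)[of t], of "real (Suc t) ^ p"] alive_nonneg[of K \<mu> t]
      by (simp add: abs_mult mult_ac)
  qed
qed

text \<open>Ensures that the \<open>suminf\<close> in \<open>occupancy\<close> denotes the true sum
  of its series.\<close>

lemma summable_occupancy_at:
  fixes K :: "'n::finite \<Rightarrow> 'n option pmf"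
  assumes "proper K"
  shows "summable (\<lambda>t. occupancy_at K \<zeta> t x)"
proof (rule summable_comparison_test')
  show "summable (alive K (map_pmf Some \<zeta>))" using summable_alive[OF assms, of 0] by simp
  show "norm (occupancy_at K \<zeta> t x) \<le> alive K (map_pmf Some \<zeta>) t" for t
    unfolding occupancy_at_eq alive_eq_sum
    by (simp, rule member_le_sum[of x UNIV "\<lambda>x. pmf (state_pmf K (map_pmf Some \<zeta>) t) (Some x)"]) auto
qed

text \<open>Split off time 0. A nonterminal state occupied at time t + 1 was entered from a
  nonterminal state at time t, because the terminal state leads only to itself.\<close>

lemma occupancy_balance:
  fixes K :: "'n::finite \<Rightarrow> 'n option pmf"
  assumes "proper K"
  shows "occupancy K \<zeta> y = pmf \<zeta> y + (\<Sum>x\<in>UNIV. occupancy K \<zeta> x * pmf (K x) (Some y))"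
proof -
  have "occupancy K \<zeta> y = occupancy_at K \<zeta> 0 y + (\<Sum>t. occupancy_at K \<zeta> (Suc t) y)"
    unfolding occupancy_def by (subst suminf_split_head[OF summable_occupancy_at[OF assms]]) simp
  also have "occupancy_at K \<zeta> 0 y = pmf \<zeta> y"
    by (simp add: occupancy_at_eq pmf_map_inj')
  also have "(\<lambda>t. occupancy_at K \<zeta> (Suc t) y) =
      (\<lambda>t. \<Sum>x\<in>UNIV. occupancy_at K \<zeta> t x * pmf (K x) (Some y))"
    by (simp add: occupancy_at_eq state_pmf_Suc pmf_bind_finite sum_option_UNIV step_def)
  also have "(\<Sum>t. \<Sum>x\<in>UNIV. occupancy_at K \<zeta> t x * pmf (K x) (Some y)) =
      (\<Sum>x\<in>UNIV. occupancy K \<zeta> x * pmf (K x) (Some y))"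
    by (simp add: occupancy_def suminf_sum summable_mult2 suminf_mult2 summable_occupancy_at[OF assms])
  finally show ?thesis .
qed

subsection \<open>Sums along a trajectory\<close>

definition path_sum ::
  "('n option \<Rightarrow> 'n option \<Rightarrow> 'v) \<Rightarrow> (nat \<Rightarrow> 'n option) \<Rightarrow> 'v::real_vector" where
  "path_sum g x = (\<Sum>t<hit_time x. g (x t) (x (Suc t)))"

text \<open>The occupancy weights absorb the sum over time. For \<open>g\<close> vanishing at a
  terminal first argument this is the mean of \<open>path_sum g\<close>, as
  \<open>expectation_path_sum\<close> shows for real values. The general value type treats vector
  and matrix statistics alike.\<close>

definition transition_mean ::
  "('n::finite \<Rightarrow> 'n option pmf) \<Rightarrow> 'n pmf \<Rightarrow> ('n option \<Rightarrow> 'n option \<Rightarrow> 'v) \<Rightarrow> 'v::real_vector" where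
  "transition_mean K \<zeta> g =
    (\<Sum>a\<in>UNIV. occupancy K \<zeta> a *\<^sub>R (\<Sum>z\<in>UNIV. pmf (K a) z *\<^sub>R g (Some a) z))"

abbreviation trajectory_space :: "(nat \<Rightarrow> 'n option) measure" where
  "trajectory_space \<equiv> Pi\<^sub>M UNIV (\<lambda>_. count_space UNIV)"

lemma measurable_coordinate [measurable]:
  "(\<lambda>x. x t) \<in> measurable trajectory_space (count_space UNIV)"
  by (rule measurable_component_singleton) simp

lemma measurable_hit_time [measurable]: "hit_time \<in> measurable trajectory_space (count_space UNIV)"
  unfolding hit_time_def Inf_nat_def mem_Collect_eq by measurable

text \<open>The number of summands is random but takes countably many values, so measurability for
  each fixed number of summands suffices.\<close>

lemma borel_measurable_path_sum [measurable]:
  fixes g :: "'n::finite option \<Rightarrow> 'n option \<Rightarrow> real"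
  shows "path_sum g \<in> borel_measurable trajectory_space"
proof -
  have "(\<lambda>x. (\<lambda>p. g (fst p) (snd p)) (x t, x (Suc t))) \<in> borel_measurable trajectory_space" for t
    by (rule measurable_compose[where N = "count_space UNIV"]) measurable
  then have [measurable]: "(\<lambda>x. g (x t) (x (Suc t))) \<in> borel_measurable trajectory_space" for t
    by simp
  have "(\<lambda>x. (\<lambda>m. \<Sum>t<m. g (x t) (x (Suc t))) (hit_time x)) \<in> borel_measurable trajectory_space"
    by (rule measurable_compose_countable) measurable
  then show ?thesis by (simp add: path_sum_def[abs_def])
qed

text \<open>One member of the sample. Its law is given through finite initial segments, from which
  the statements about the hitting time have to be derived.\<close>

locale absorbing_trajectory = prob_space M for M :: "'w measure" +
  fixes K :: "'n::finite \<Rightarrow> 'n option pmf" and \<zeta> :: "'n pmf" and x :: "'w \<Rightarrow> nat \<Rightarrow> 'n option"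
  assumes proper: "proper K"
    and traj_measurable [measurable]: "x \<in> measurable M trajectory_space"
    and law: "\<And>t. distr M (count_space UNIV) (\<lambda>\<omega>. map (x \<omega>) [0..<Suc t]) =
      measure_pmf (path_pmf K (map_pmf Some \<zeta>) t)"
begin

abbreviation \<mu> where "\<mu> \<equiv> map_pmf Some \<zeta>"

lemma state_measurable [measurable]: "(\<lambda>\<omega>. x \<omega> t) \<in> measurable M (count_space UNIV)"
  by measurable

text \<open>Needed to push \<open>law\<close> forward along maps of the initial segment. Lists over
  a finite set are countable, so preimages of single lists suffice, and these are finite
  intersections of coordinate events.\<close>

lemma path_measurable:
  "(\<lambda>\<omega>. map (x \<omega>) [0..<t]) \<in> measurable M (count_space UNIV)"
proof -
  have "countable (UNIV :: 'n option list set)"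
    using countable_lists[of "UNIV :: 'n option set"] by (simp add: uncountable_infinite)
  moreover have "(\<lambda>\<omega>. map (x \<omega>) [0..<t]) -` {l} \<inter> space M \<in> sets M" for l
  proof -
    have "map (x \<omega>) [0..<t] = l \<longleftrightarrow> length l = t \<and> (\<forall>i\<in>{..<t}. x \<omega> i = l ! i)" for \<omega>
      unfolding list_eq_iff_nth_eq by (simp add: Ball_def conj_commute cong: conj_cong) blast
    then have "(\<lambda>\<omega>. map (x \<omega>) [0..<t]) -` {l} \<inter> space M =
        {\<omega> \<in> space M. length l = t \<and> (\<forall>i\<in>{..<t}. x \<omega> i = l ! i)}"
      by (simp only: vimage_def Int_def mem_Collect_eq singleton_iff conj_commute)
    also have "\<dots> \<in> sets M" by measurable
    finally show ?thesis .
  qed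
  ultimately show ?thesis
    by (subst measurable_count_space_eq_countable) simp_all
qed

lemma distr_transition:
  "distr M (count_space UNIV) (\<lambda>\<omega>. (x \<omega> t, x \<omega> (Suc t))) =
    measure_pmf (bind_pmf (state_pmf K \<mu> t) (\<lambda>z. map_pmf (Pair z) (step K z)))"
  unfolding transition_pmf_path[symmetric] map_pmf_rep_eq law[symmetric]
  by (subst distr_distr) (auto simp: path_measurable comp_def simp del: upt_Suc intro!: distr_cong)

lemma distr_state: "distr M (count_space UNIV) (\<lambda>\<omega>. x \<omega> t) = measure_pmf (state_pmf K \<mu> t)"
  unfolding state_pmf_def map_pmf_rep_eq law[symmetric]
  by (subst distr_distr) (auto simp: path_measurable comp_def last_conv_nth simp del: upt_Suc intro!: distr_cong)

lemma prob_alive: "prob {\<omega> \<in> space M. x \<omega> t \<noteq> None} = alive K \<mu> t"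
proof -
  have "prob {\<omega> \<in> space M. x \<omega> t \<noteq> None} = measure (distr M (count_space UNIV) (\<lambda>\<omega>. x \<omega> t)) (UNIV - {None})"
    by (subst measure_distr) (auto intro!: arg_cong[where f = prob])
  also have "\<dots> = alive K \<mu> t"
    unfolding distr_state using measure_pmf.prob_compl[of "{None}" "state_pmf K \<mu> t"]
    by (simp add: alive_def measure_pmf_single)
  finally show ?thesis .
qed

lemma integrable_alive: "integrable M (indicat_real {\<omega> \<in> space M. x \<omega> t \<noteq> None})"
  by (intro integrable_real_indicator) (simp_all add: emeasure_eq_measure)

lemma AE_start: "AE \<omega> in M. x \<omega> 0 \<noteq> None"
proof -
  have "AE z in distr M (count_space UNIV) (\<lambda>\<omega>. x \<omega> 0). z \<noteq> None"
    unfolding distr_state by (auto simp: AE_measure_pmf_iff)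
  then show ?thesis by (subst (asm) AE_distr_iff) auto
qed

lemma AE_absorbed: "AE \<omega> in M. \<forall>t. x \<omega> t = None \<longrightarrow> x \<omega> (Suc t) = None"
proof (subst AE_all_countable, intro allI)
  fix t
  have "AE p in distr M (count_space UNIV) (\<lambda>\<omega>. (x \<omega> t, x \<omega> (Suc t))). fst p = None \<longrightarrow> snd p = None"
    unfolding distr_transition by (auto simp: AE_measure_pmf_iff step_def)
  then show "AE \<omega> in M. x \<omega> t = None \<longrightarrow> x \<omega> (Suc t) = None"
    by (subst (asm) AE_distr_iff) auto
qed

text \<open>Borel-Cantelli: the survival probabilities are summable, so almost surely the chain is
  alive at only finitely many times.\<close>

lemma AE_hits: "AE \<omega> in M. \<exists>t. x \<omega> t = None"
proof -
  have "AE \<omega> in M. \<forall>\<^sub>F t in sequentially. \<omega> \<in> space M - {\<omega> \<in> space M. x \<omega> t \<noteq> None}"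
    using summable_alive[OF proper, of 0 \<mu>]
    by (intro borel_cantelli_AE1) (simp_all add: prob_alive emeasure_eq_measure del: not_None_eq)
  then show ?thesis by eventually_elim (auto simp: eventually_sequentially)
qed

text \<open>Outside three null events (starting in the terminal state, leaving it, never reaching
  it) the hitting time separates nonterminal from terminal times. The start matters because
  \<open>hit_time\<close> looks only at positive times. This turns sums with a random upper limit
  into series over all times.\<close>

lemma AE_less_hit_time: "AE \<omega> in M. \<forall>t. t < hit_time (x \<omega>) \<longleftrightarrow> x \<omega> t \<noteq> None"
  using AE_start AE_absorbed AE_hits
proof eventually_elim
  case (elim \<omega>)
  then obtain t where t: "x \<omega> t = None" by blast
  with elim have "t > 0" by (cases t) auto
  define h where "h = hit_time (x \<omega>)"
  have "h = (LEAST k. 0 < k \<and> x \<omega> k = None)" by (simp add: h_def hit_time_def Inf_nat_def)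
  then have h: "x \<omega> h = None" and least: "\<And>k. 0 < k \<Longrightarrow> x \<omega> k = None \<Longrightarrow> h \<le> k"
    using LeastI[of "\<lambda>k. 0 < k \<and> x \<omega> k = None" t] Least_le[of "\<lambda>k. 0 < k \<and> x \<omega> k = None"] \<open>t > 0\<close> t
    by auto
  have "x \<omega> k = None" if "h \<le> k" for k
    using that
  proof (induction k rule: dec_induct)
    case (step k)
    then show ?case using elim(2) by blast
  qed (rule h)
  moreover have "h \<le> k" if "x \<omega> k = None" for k
    using least[of k] that elim(1) by (cases k) auto
  ultimately have "x \<omega> k = None \<longleftrightarrow> h \<le> k" for k by blast
  then show ?case by (simp add: h_def not_le[symmetric] del: not_le not_None_eq)
qed

text \<open>The summand \<open>0 ^ p\<close> accounts for \<open>0 ^ 0 = 1\<close> on the null event \<open>hit_time = 0\<close>.\<close>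

lemma moment_hit_time:
  shows "integrable M (\<lambda>\<omega>. real (hit_time (x \<omega>)) ^ p)"
    and "expectation (\<lambda>\<omega>. real (hit_time (x \<omega>)) ^ p) \<le> 0 ^ p + (\<Sum>t. real (Suc t) ^ p * alive K \<mu> t)"
proof -
  define f where "f = (\<lambda>t \<omega>. real (Suc t) ^ p * indicator {\<omega> \<in> space M. x \<omega> t \<noteq> None} \<omega> :: real)"
  have [measurable]: "f t \<in> borel_measurable M" for t unfolding f_def by measurable
  have f0: "f t \<omega> \<ge> 0" for t \<omega> by (simp add: f_def)
  have "(\<integral>\<^sup>+\<omega>. ennreal (real (hit_time (x \<omega>)) ^ p) \<partial>M) \<le> (\<integral>\<^sup>+\<omega>. ennreal (0 ^ p) + (\<Sum>t. ennreal (f t \<omega>)) \<partial>M)"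
  proof (rule nn_integral_mono_AE)
    show "AE \<omega> in M. ennreal (real (hit_time (x \<omega>)) ^ p) \<le> ennreal (0 ^ p) + (\<Sum>t. ennreal (f t \<omega>))"
      using AE_less_hit_time AE_space
    proof eventually_elim
      case (elim \<omega>)
      show ?case
      proof (cases "hit_time (x \<omega>)")
        case (Suc s)
        \<comment> \<open>The last nonterminal time \<open>s\<close> is
          \<open>hit_time (x \<omega>) - 1\<close>, so the single term \<open>f s \<omega>\<close>
          already equals the p-th power of the hitting time.\<close>
        have "x \<omega> s \<noteq> None" using elim(1) Suc by auto
        then have "ennreal (real (hit_time (x \<omega>)) ^ p) = (\<Sum>t\<in>{s}. ennreal (f t \<omega>))"
          using elim by (simp add: f_def Suc)
        also have "\<dots> \<le> (\<Sum>t. ennreal (f t \<omega>))" by (intro sum_le_suminf) auto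
        finally show ?thesis by (metis add.commute add_increasing2 zero_le)
      qed simp
    qed
  qed
  also have "\<dots> = ennreal (0 ^ p) + (\<Sum>t. \<integral>\<^sup>+\<omega>. ennreal (f t \<omega>) \<partial>M)"
    by (simp add: nn_integral_add nn_integral_suminf emeasure_space_1)
  also have "(\<lambda>t. \<integral>\<^sup>+\<omega>. ennreal (f t \<omega>) \<partial>M) = (\<lambda>t. ennreal (real (Suc t) ^ p * alive K \<mu> t))"
  proof
    fix t
    have "(\<integral>\<^sup>+\<omega>. ennreal (f t \<omega>) \<partial>M) = ennreal (expectation (f t))"
      by (intro nn_integral_eq_integral) (auto simp: f0 f_def[abs_def] intro!: integrable_mult_right integrable_alive simp del: not_None_eq)
    then show "(\<integral>\<^sup>+\<omega>. ennreal (f t \<omega>) \<partial>M) = ennreal (real (Suc t) ^ p * alive K \<mu> t)"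
      by (simp add: f_def prob_alive del: not_None_eq)
  qed
  also have "(\<Sum>t. ennreal (real (Suc t) ^ p * alive K \<mu> t)) = ennreal (\<Sum>t. real (Suc t) ^ p * alive K \<mu> t)"
    by (intro suminf_ennreal2 summable_alive proper) (simp add: alive_nonneg)
  also have "ennreal (0 ^ p) + \<dots> = ennreal (0 ^ p + (\<Sum>t. real (Suc t) ^ p * alive K \<mu> t))"
    by (intro ennreal_plus[symmetric] suminf_nonneg summable_alive proper) (auto simp: alive_nonneg)
  finally have le: "(\<integral>\<^sup>+\<omega>. ennreal (real (hit_time (x \<omega>)) ^ p) \<partial>M) \<le>
    ennreal (0 ^ p + (\<Sum>t. real (Suc t) ^ p * alive K \<mu> t))" .
  show int: "integrable M (\<lambda>\<omega>. real (hit_time (x \<omega>)) ^ p)"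
    by (rule integrableI_nonneg) (use le in \<open>auto intro: le_less_trans\<close>)
  have "0 \<le> 0 ^ p + (\<Sum>t. real (Suc t) ^ p * alive K \<mu> t)"
    by (intro add_nonneg_nonneg suminf_nonneg summable_alive proper) (auto simp: alive_nonneg)
  then show "expectation (\<lambda>\<omega>. real (hit_time (x \<omega>)) ^ p) \<le> 0 ^ p + (\<Sum>t. real (Suc t) ^ p * alive K \<mu> t)"
    using le by (subst (asm) nn_integral_eq_integral[OF int]) (auto simp: ennreal_le_iff)
qed

context
  fixes g :: "'n option \<Rightarrow> 'n option \<Rightarrow> real"
begin

definition bound where "bound = Max (range (\<lambda>p. \<bar>g (fst p) (snd p)\<bar>))"

lemma abs_le_bound: "\<bar>g z z'\<bar> \<le> bound"
  unfolding bound_def by (rule Max_ge) (auto intro: image_eqI[where x = "(z, z')"])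

lemma path_sum_bound: "\<bar>path_sum g y\<bar> \<le> bound * real (hit_time y)"
  using sum_bounded_above[of "{..<hit_time y}" "\<lambda>t. \<bar>g (y t) (y (Suc t))\<bar>" bound] abs_le_bound
  unfolding path_sum_def by (intro order_trans[OF sum_abs]) (simp add: mult.commute)

text \<open>A path sum is at most a constant times the hitting time. The resulting bound depends
  only on \<open>g\<close>, the chain and its initial law, hence is the same for all sampled
  trajectories.\<close>

lemma path_sum_moment:
  shows "integrable M (\<lambda>\<omega>. path_sum g (x \<omega>) ^ 4)"
    and "expectation (\<lambda>\<omega>. path_sum g (x \<omega>) ^ 4) \<le> bound ^ 4 * (\<Sum>t. real (Suc t) ^ 4 * alive K \<mu> t)"
proof -
  have pt: "path_sum g y ^ 4 \<le> bound ^ 4 * real (hit_time y) ^ 4" for y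
    using power_mono[OF path_sum_bound[of y], of 4] by (simp add: power_mult_distrib)
  have int: "integrable M (\<lambda>\<omega>. bound ^ 4 * real (hit_time (x \<omega>)) ^ 4)"
    by (intro integrable_mult_right moment_hit_time)
  show int': "integrable M (\<lambda>\<omega>. path_sum g (x \<omega>) ^ 4)"
    by (rule Bochner_Integration.integrable_bound[OF int]) (auto simp: pt)
  have "expectation (\<lambda>\<omega>. path_sum g (x \<omega>) ^ 4) \<le> expectation (\<lambda>\<omega>. bound ^ 4 * real (hit_time (x \<omega>)) ^ 4)"
    using int int' pt by (intro integral_mono) auto
  also have "\<dots> \<le> bound ^ 4 * (\<Sum>t. real (Suc t) ^ 4 * alive K \<mu> t)"
    using moment_hit_time(2)[of 4] by (simp add: mult_left_mono)
  finally show "expectation (\<lambda>\<omega>. path_sum g (x \<omega>) ^ 4) \<le> bound ^ 4 * (\<Sum>t. real (Suc t) ^ 4 * alive K \<mu> t)" .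
qed

lemma expectation_transition:
  assumes "\<And>z. g None z = 0"
  shows "expectation (\<lambda>\<omega>. g (x \<omega> t) (x \<omega> (Suc t))) =
    (\<Sum>a\<in>UNIV. occupancy_at K \<zeta> t a * (\<Sum>z\<in>UNIV. pmf (K a) z * g (Some a) z))"
proof -
  have "expectation (\<lambda>\<omega>. g (x \<omega> t) (x \<omega> (Suc t))) =
      (\<integral>p. g (fst p) (snd p) \<partial>distr M (count_space UNIV) (\<lambda>\<omega>. (x \<omega> t, x \<omega> (Suc t))))"
    by (subst integral_distr) auto
  also have "\<dots> = (\<Sum>p\<in>UNIV. pmf (bind_pmf (state_pmf K \<mu> t) (\<lambda>z. map_pmf (Pair z) (step K z))) p * g (fst p) (snd p))"
    unfolding distr_transition by (subst integral_measure_pmf[of UNIV]) auto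
  also have "\<dots> = (\<Sum>z\<in>UNIV. \<Sum>z'\<in>UNIV. pmf (state_pmf K \<mu> t) z * pmf (step K z) z' * g z z')"
  proof -
    have "pmf (map_pmf (Pair w) (step K w)) (z, z') = (if w = z then pmf (step K z) z' else 0)" for w z z'
      by (auto simp: pmf_map_inj' inj_on_def pmf_eq_0_set_pmf)
    then have "pmf (bind_pmf (state_pmf K \<mu> t) (\<lambda>z. map_pmf (Pair z) (step K z))) p =
        pmf (state_pmf K \<mu> t) (fst p) * pmf (step K (fst p)) (snd p)" for p
      by (cases p) (simp add: pmf_bind_finite if_distrib[of "\<lambda>y. _ * y"] cong: if_cong)
    then show ?thesis
      by (simp add: sum.cartesian_product case_prod_beta flip: UNIV_Times_UNIV)
  qed
  also have "\<dots> = (\<Sum>a\<in>UNIV. occupancy_at K \<zeta> t a * (\<Sum>z\<in>UNIV. pmf (K a) z * g (Some a) z))"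
    by (subst sum_option_UNIV) (simp add: assms occupancy_at_eq step_def sum_distrib_left mult.assoc)
  finally show ?thesis .
qed

text \<open>Terms from the hitting time on vanish by \<open>g0\<close>, so the path sum is almost
  surely a series over all times. The bound \<open>bound * alive K \<mu> t\<close> on the absolute
  means permits exchanging series and expectation, and summing over time produces the occupancy
  weights.\<close>

lemma expectation_path_sum:
  assumes g0: "\<And>z. g None z = 0"
  shows "expectation (\<lambda>\<omega>. path_sum g (x \<omega>)) = transition_mean K \<zeta> g"
proof -
  define f where "f = (\<lambda>t \<omega>. g (x \<omega> t) (x \<omega> (Suc t)))"
  define c where "c = (\<lambda>a. \<Sum>z\<in>UNIV. pmf (K a) z * g (Some a) z)"
  have f_meas [measurable]: "f t \<in> borel_measurable M" for t
  proof -
    have "(\<lambda>\<omega>. (\<lambda>p. g (fst p) (snd p)) (x \<omega> t, x \<omega> (Suc t))) \<in> borel_measurable M"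
      by (rule measurable_compose[where N = "count_space UNIV"]) measurable
    then show ?thesis by (simp add: f_def)
  qed
  have f_int: "integrable M (f t)" for t
    by (rule integrable_const_bound[where B = bound]) (auto simp: f_def abs_le_bound)
  have zero: "AE \<omega> in M. \<forall>t. t \<notin> {..<hit_time (x \<omega>)} \<longrightarrow> f t \<omega> = 0"
    using AE_less_hit_time by eventually_elim (auto simp: f_def g0)
  have "AE \<omega> in M. path_sum g (x \<omega>) = (\<Sum>t. f t \<omega>)"
    using zero
  proof eventually_elim
    case (elim \<omega>)
    then have "(\<Sum>t. f t \<omega>) = (\<Sum>t<hit_time (x \<omega>). f t \<omega>)" by (intro suminf_finite) auto
    then show ?case by (simp add: path_sum_def f_def)
  qed
  then have "expectation (\<lambda>\<omega>. path_sum g (x \<omega>)) = expectation (\<lambda>\<omega>. \<Sum>t. f t \<omega>)"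
    by (intro integral_cong_AE) measurable
  also have "\<dots> = (\<Sum>t. expectation (f t))"
  proof (rule integral_suminf[OF f_int])
    show "AE \<omega> in M. summable (\<lambda>t. norm (f t \<omega>))"
      using zero by eventually_elim (rule summable_finite[of "{..<hit_time _}"], auto)
    show "summable (\<lambda>t. expectation (\<lambda>\<omega>. norm (f t \<omega>)))"
    proof (rule summable_comparison_test')
      show "summable (\<lambda>t. bound * alive K \<mu> t)"
        using summable_alive[OF proper, of 0 \<mu>] by (intro summable_mult) simp
      fix t
      have "expectation (\<lambda>\<omega>. norm (f t \<omega>)) \<le>
          expectation (\<lambda>\<omega>. bound * indicator {\<omega> \<in> space M. x \<omega> t \<noteq> None} \<omega>)"
      proof (intro integral_mono integrable_mult_right integrable_alive)
        show "norm (f t \<omega>) \<le> bound * indicator {\<omega> \<in> space M. x \<omega> t \<noteq> None} \<omega>" if "\<omega> \<in> space M" for \<omega>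
          using abs_le_bound that by (cases "x \<omega> t") (simp_all add: f_def g0)
      qed (use f_int[of t] in simp)
      then show "norm (expectation (\<lambda>\<omega>. norm (f t \<omega>))) \<le> bound * alive K \<mu> t"
        by (simp add: prob_alive del: not_None_eq)
    qed
  qed
  also have "\<dots> = (\<Sum>t. \<Sum>a\<in>UNIV. occupancy_at K \<zeta> t a * c a)"
    by (simp add: f_def expectation_transition[OF g0] c_def)
  also have "\<dots> = (\<Sum>a\<in>UNIV. occupancy K \<zeta> a * c a)"
    by (simp add: occupancy_def suminf_sum summable_mult2 suminf_mult2 summable_occupancy_at[OF proper])
  finally show ?thesis by (simp add: transition_mean_def c_def)
qed

end

end

subsection \<open>The limiting equations\<close>

lemma linear_transition_mean:
  assumes "linear f"
  shows "f (transition_mean K \<zeta> g) = transition_mean K \<zeta> (\<lambda>z z'. f (g z z'))"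
  by (simp add: transition_mean_def linear_sum[OF assms] linear_scale[OF assms])

lemma linear_sample_mean_path_sum:
  assumes "linear f"
  shows "f (sample_mean (path_sum g) xs N) = sample_mean (path_sum (\<lambda>z z'. f (g z z'))) xs N"
  by (simp add: sample_mean_def path_sum_def linear_sum[OF assms] linear_scale[OF assms])

lemma transition_mean_add:
  "transition_mean K \<zeta> (\<lambda>z z'. g z z' + h z z') = transition_mean K \<zeta> g + transition_mean K \<zeta> h"
  by (simp add: transition_mean_def scaleR_add_right sum.distrib)

lemma sample_mean_path_sum_add:
  "sample_mean (path_sum (\<lambda>z z'. g z z' + h z z')) xs N =
    sample_mean (path_sum g) xs N + sample_mean (path_sum h) xs N"
  by (simp add: sample_mean_def path_sum_def scaleR_add_right sum.distrib)

lemma (in prob_space) strong_law_path_sum_real: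
  fixes g :: "'n::finite option \<Rightarrow> 'n option \<Rightarrow> real"
  assumes proper: "proper K" and iid: "iid_trajectories M K \<zeta> X" and g0: "\<And>z. g None z = 0"
  shows "AE \<omega> in M. sample_mean (path_sum g) (\<lambda>k. X k \<omega>) \<longlonglongrightarrow> transition_mean K \<zeta> g"
proof -
  have ind: "indep_vars (\<lambda>_. trajectory_space) X UNIV"
    using iid by (simp add: iid_trajectories_def)
  have traj: "absorbing_trajectory M K \<zeta> (X k)" for k
    using iid proper ind prob_space_axioms
    by (simp add: iid_trajectories_def absorbing_trajectory_def absorbing_trajectory_axioms_def indep_vars_def)
  have "indep_vars (\<lambda>_. borel) (\<lambda>k \<omega>. path_sum g (X k \<omega>)) UNIV"
    by (rule indep_vars_compose2[OF ind]) measurable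
  then have "AE \<omega> in M. (\<lambda>N. (\<Sum>k<N. path_sum g (X k \<omega>)) / real N) \<longlonglongrightarrow> transition_mean K \<zeta> g"
    by (rule strong_law_bounded_fourth_moments)
       (rule absorbing_trajectory.path_sum_moment[OF traj] absorbing_trajectory.expectation_path_sum[OF traj] g0)+
  then show ?thesis by (simp add: sample_mean_def[abs_def])
qed

text \<open>The real case is applied to the finitely many coordinates, which share one almost sure
  event.\<close>

theorem (in prob_space) strong_law_path_sum:
  fixes g :: "'n::finite option \<Rightarrow> 'n option \<Rightarrow> 'v::euclidean_space"
  assumes "proper K" and "iid_trajectories M K \<zeta> X" and g0: "\<And>z. g None z = 0"
  shows "AE \<omega> in M. sample_mean (path_sum g) (\<lambda>k. X k \<omega>) \<longlonglongrightarrow> transition_mean K \<zeta> g"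
proof -
  have "AE \<omega> in M. \<forall>b\<in>Basis. sample_mean (path_sum (\<lambda>z z'. g z z' \<bullet> b)) (\<lambda>k. X k \<omega>) \<longlonglongrightarrow>
      transition_mean K \<zeta> (\<lambda>z z'. g z z' \<bullet> b)"
    by (intro AE_finite_allI strong_law_path_sum_real assms) (simp_all add: g0)
  then show ?thesis
  proof eventually_elim
    case (elim \<omega>)
    have lin: "linear (\<lambda>v. v \<bullet> b)" for b :: 'v
      by (rule bounded_linear.linear[OF bounded_linear_inner_left])
    show ?case
      by (subst tendsto_componentwise_iff)
         (use elim in \<open>simp add: linear_sample_mean_path_sum[OF lin] linear_transition_mean[OF lin]\<close>)
  qed
qed

section \<open>The limit matrix and the projected equations\<close>

definition feature_moment :: "('n::finite \<Rightarrow> real) \<Rightarrow> real ^ 'l ^ 'n \<Rightarrow> real ^ 'n \<Rightarrow> real ^ 'l" where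
  "feature_moment q \<Phi> c = (\<Sum>a\<in>UNIV. (q a * c $ a) *\<^sub>R \<Phi> $ a)"

lemma feature_moment_diff: "feature_moment q \<Phi> (c - d) = feature_moment q \<Phi> c - feature_moment q \<Phi> d"
  by (simp add: feature_moment_def algebra_simps sum_subtractf)

lemma weighted_inner_feature: "weighted_inner q c (\<Phi> *v v) = feature_moment q \<Phi> c \<bullet> v"
  by (simp add: weighted_inner_def feature_moment_def inner_sum_left matrix_vector_mul_component)

lemma feature_simps [simp]:
  "feature \<Phi> None = 0" "feature \<Phi> (Some a) = \<Phi> $ a" "reward r None = 0" "reward r (Some a) = r $ a"
  by (simp_all add: feature_def reward_def)

lemma outer_mult_vector: "outer u v *v w = (v \<bullet> w) *\<^sub>R u"
  by (simp add: vec_eq_iff outer_def matrix_vector_mult_def inner_vec_def sum_distrib_left sum_distrib_right mult_ac)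

lemma outer_zero [simp]: "outer 0 v = 0"
  by (simp add: vec_eq_iff outer_def)

lemma linear_apply_matrix: "linear (\<lambda>A. A *v w)" for w :: "real ^ 'l"
  by (simp add: linear_iff matrix_vector_mult_add_rdistrib scaleR_matrix_vector_assoc)

lemma sum_pmf_UNIV: "(\<Sum>z\<in>UNIV. pmf p z) = 1" for p :: "'a::finite pmf"
  by (simp add: sum_pmf_eq_1)

lemma trans_matrix_apply:
  "(trans_matrix K *v (\<Phi> *v w)) $ a = (\<Sum>z\<in>UNIV. pmf (K a) z * (feature \<Phi> z \<bullet> w))"
  by (simp add: sum_option_UNIV trans_matrix_def matrix_vector_mult_def inner_vec_def)

lemma transition_mean_feature:
  "transition_mean K \<zeta> (\<lambda>z z'. h z z' *\<^sub>R feature \<Phi> z) =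
    feature_moment (occupancy K \<zeta>) \<Phi> (\<chi> a. \<Sum>z\<in>UNIV. pmf (K a) z * h (Some a) z)"
  by (simp add: transition_mean_def feature_moment_def scaleR_sum_left[symmetric])

definition lstd_limit_matrix ::
  "('n::finite \<Rightarrow> 'n option pmf) \<Rightarrow> 'n pmf \<Rightarrow> real ^ 'l ^ 'n \<Rightarrow> real ^ 'l ^ 'l" where
  "lstd_limit_matrix K \<zeta> \<Phi> =
    transition_mean K \<zeta> (\<lambda>z z'. outer (feature \<Phi> z) (feature \<Phi> z - feature \<Phi> z'))"

lemma lstd_limit_matrix_apply:
  "lstd_limit_matrix K \<zeta> \<Phi> *v w =
    transition_mean K \<zeta> (\<lambda>z z'. ((feature \<Phi> z - feature \<Phi> z') \<bullet> w) *\<^sub>R feature \<Phi> z)"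
  by (simp add: lstd_limit_matrix_def linear_transition_mean[OF linear_apply_matrix] outer_mult_vector)

text \<open>As \<open>feature_moment q \<Phi> c\<close> is \<Phi>^T Q c, this identifies the limit
  matrix as \<Phi>^T Q (I - P) \<Phi>. The terminal state drops out because its feature is
  0.\<close>

lemma lstd_limit_matrix_moment:
  "lstd_limit_matrix K \<zeta> \<Phi> *v w =
    feature_moment (occupancy K \<zeta>) \<Phi> (\<Phi> *v w - trans_matrix K *v (\<Phi> *v w))"
  unfolding lstd_limit_matrix_apply transition_mean_feature
  by (rule arg_cong[where f = "feature_moment _ _"])
     (simp add: vec_eq_iff trans_matrix_apply[unfolded matrix_vector_mul_component] inner_diff_left right_diff_distrib sum_subtractf
       sum_pmf_UNIV matrix_vector_mul_component flip: sum_distrib_right)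

text \<open>Twice (y z - y z') y z equals (y z - y z')^2 + (y z)^2 - (y z')^2. In the mean, the
  balance equation cancels the last two squares up to the contribution of the initial law.\<close>

lemma transition_energy:
  fixes K :: "'n::finite \<Rightarrow> 'n option pmf"
  assumes "proper K" and y0: "y None = 0"
  shows "2 * transition_mean K \<zeta> (\<lambda>z z'. (y z - y z') * y z) =
    transition_mean K \<zeta> (\<lambda>z z'. (y z - y z')\<^sup>2) + (\<Sum>x\<in>UNIV. pmf \<zeta> x * (y (Some x))\<^sup>2)"
proof -
  let ?q = "occupancy K \<zeta>"
  have balance: "?q x - pmf \<zeta> x = (\<Sum>a\<in>UNIV. ?q a * pmf (K a) (Some x))" for x
    using occupancy_balance[OF assms(1), of \<zeta> x] by linarith
  have "2 * transition_mean K \<zeta> (\<lambda>z z'. (y z - y z') * y z) =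
      transition_mean K \<zeta> (\<lambda>z z'. 2 * ((y z - y z') * y z))"
    by (rule linear_transition_mean) (simp add: linear_iff algebra_simps)
  also have "(\<lambda>z z'. 2 * ((y z - y z') * y z)) = (\<lambda>z z'. (y z - y z')\<^sup>2 + ((y z)\<^sup>2 - (y z')\<^sup>2))"
    by (simp add: fun_eq_iff power2_eq_square algebra_simps)
  also have "transition_mean K \<zeta> \<dots> = transition_mean K \<zeta> (\<lambda>z z'. (y z - y z')\<^sup>2) +
      transition_mean K \<zeta> (\<lambda>z z'. (y z)\<^sup>2 - (y z')\<^sup>2)"
    by (rule transition_mean_add)
  also have "transition_mean K \<zeta> (\<lambda>z z'. (y z)\<^sup>2 - (y z')\<^sup>2) =
      (\<Sum>x\<in>UNIV. ?q x * (y (Some x))\<^sup>2) -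
      (\<Sum>a\<in>UNIV. \<Sum>x\<in>UNIV. ?q a * pmf (K a) (Some x) * (y (Some x))\<^sup>2)"
    by (simp add: transition_mean_def right_diff_distrib sum_subtractf sum_pmf_UNIV sum_option_UNIV[of "\<lambda>z. _ z * (y z)\<^sup>2"]
        y0 sum_distrib_left mult.assoc flip: sum_distrib_right)
  also have "(\<Sum>a\<in>UNIV. \<Sum>x\<in>UNIV. ?q a * pmf (K a) (Some x) * (y (Some x))\<^sup>2) =
      (\<Sum>x\<in>UNIV. (?q x - pmf \<zeta> x) * (y (Some x))\<^sup>2)"
    by (subst sum.swap) (simp add: balance flip: sum_distrib_right)
  finally show ?thesis by (simp add: left_diff_distrib sum_subtractf)
qed

lemma harmonic_on_paths:
  assumes har: "\<And>a z. z \<in> set_pmf (K a) \<Longrightarrow> y z = y (Some a)"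
  shows "zs \<in> set_pmf (path_pmf K (return_pmf (Some a)) t) \<Longrightarrow> z \<in> set zs \<Longrightarrow> y z = y (Some a)"
proof (induction t arbitrary: zs z)
  case (Suc t)
  then obtain ys w where w: "ys \<in> set_pmf (path_pmf K (return_pmf (Some a)) t)" "zs = ys @ [w]"
    "w \<in> set_pmf (step K (last ys))"
    by auto
  have "last ys \<in> set ys" using length_path_pmf[OF w(1)] by (intro last_in_set) auto
  then have "y (last ys) = y (Some a)" using Suc.IH w(1) by blast
  moreover have "y w = y (last ys)"
    using w(3) har by (cases "last ys") (auto simp: step_def)
  ultimately show ?case using Suc.IH[OF w(1)] Suc.prems(2) w(2) by auto
qed auto

text \<open>Properness supplies a path of positive probability from \<open>a\<close> to the terminal
  state; \<open>y\<close> is constant along it and vanishes at its end.\<close>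

lemma harmonic_eq_0:
  fixes K :: "'n::finite \<Rightarrow> 'n option pmf"
  assumes "proper K" and y0: "y None = 0"
    and har: "\<And>a z. z \<in> set_pmf (K a) \<Longrightarrow> y z = y (Some a)"
  shows "y (Some a) = 0"
proof -
  let ?p = "path_pmf K (return_pmf (Some a)) CARD('n)"
  have "measure_pmf.prob ?p {zs. None \<in> set zs} \<noteq> 0" using assms(1) by (simp add: proper_def less_le)
  then obtain zs where "zs \<in> set_pmf ?p" "None \<in> set zs"
    by (auto simp: measure_pmf_zero_iff)
  from harmonic_on_paths[where y = y, OF har this] y0 show ?thesis by simp
qed

text \<open>A zero of the quadratic form has zero energy in \<open>transition_energy\<close>. Both
  parts there are nonnegative, so positive occupancy forces \<open>y\<close> to be constant across
  every possible transition, hence zero, and injectivity of \<Phi> gives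
  \<open>v = 0\<close>.\<close>

lemma lstd_limit_matrix_invertible:
  fixes K :: "'n::finite \<Rightarrow> 'n option pmf"
  assumes "proper K" and q: "\<And>x. occupancy K \<zeta> x > 0" and inj: "inj ((*v) \<Phi>)"
  shows "invertible (lstd_limit_matrix K \<zeta> \<Phi>)"
proof (rule invertibleI_definite)
  fix v assume v: "v \<bullet> (lstd_limit_matrix K \<zeta> \<Phi> *v v) = 0"
  define y where "y = (\<lambda>z. feature \<Phi> z \<bullet> v)"
  have y0: "y None = 0" by (simp add: y_def)
  have lin: "linear (\<lambda>u. v \<bullet> u)" by (rule bounded_linear.linear[OF bounded_linear_inner_right])
  have "transition_mean K \<zeta> (\<lambda>z z'. (y z - y z') * y z) = 0"
    using v unfolding lstd_limit_matrix_apply linear_transition_mean[OF lin]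
    by (simp add: y_def inner_diff_left inner_diff_right inner_commute)
  then have "transition_mean K \<zeta> (\<lambda>z z'. (y z - y z')\<^sup>2) + (\<Sum>x\<in>UNIV. pmf \<zeta> x * (y (Some x))\<^sup>2) = 0"
    using transition_energy[OF assms(1), of y \<zeta>, OF y0] by simp
  moreover have "0 \<le> (\<Sum>x\<in>UNIV. pmf \<zeta> x * (y (Some x))\<^sup>2)" by (intro sum_nonneg) simp
  ultimately have le0: "transition_mean K \<zeta> (\<lambda>z z'. (y z - y z')\<^sup>2) \<le> 0" by linarith
  have "y z = y (Some a)" if "z \<in> set_pmf (K a)" for a z
  proof -
    \<comment> \<open>A single transition is isolated from a double sum of nonnegative
      terms.\<close>
    have "occupancy K \<zeta> a * (pmf (K a) z * (y (Some a) - y z)\<^sup>2) \<le>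
        occupancy K \<zeta> a * (\<Sum>z\<in>UNIV. pmf (K a) z * (y (Some a) - y z)\<^sup>2)"
      using q[of a] by (intro mult_left_mono member_le_sum) auto
    also have "\<dots> \<le> transition_mean K \<zeta> (\<lambda>z z'. (y z - y z')\<^sup>2)"
      unfolding transition_mean_def real_scaleR_def
      by (intro member_le_sum mult_nonneg_nonneg sum_nonneg less_imp_le[OF q]) auto
    finally have "occupancy K \<zeta> a * (pmf (K a) z * (y (Some a) - y z)\<^sup>2) \<le> 0" using le0 by linarith
    moreover have "pmf (K a) z > 0" using that by (simp add: pmf_positive_iff)
    ultimately have "(y (Some a) - y z)\<^sup>2 \<le> 0" using q[of a] by (simp only: mult_le_0_iff) linarith
    then show ?thesis by simp
  qed
  then have "y (Some a) = 0" for a by (rule harmonic_eq_0[OF assms(1), of y, OF y0])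
  then have "\<Phi> *v v = \<Phi> *v 0"
    by (simp add: y_def vec_eq_iff matrix_vector_mul_component)
  then show "v = 0" using inj by (rule injD[rotated])
qed

text \<open>Orthogonality of the residual to the feature space is exactly the limit linear system.
  The vector \<open>c\<close> stands for the part of the equation free of \<open>w\<close>, so the
  same lemma covers both projected equations.\<close>

lemma projected_equation_iff:
  fixes K :: "'n::finite \<Rightarrow> 'n option pmf"
  assumes "proper K" and q: "\<And>x. occupancy K \<zeta> x > 0" and inj: "inj ((*v) \<Phi>)"
  shows "weighted_proj (occupancy K \<zeta>) (feature_space \<Phi>) (c + trans_matrix K *v (\<Phi> *v w)) = \<Phi> *v w \<longleftrightarrow>
    w = matrix_inv (lstd_limit_matrix K \<zeta> \<Phi>) *v feature_moment (occupancy K \<zeta>) \<Phi> c"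
proof -
  have "c + trans_matrix K *v (\<Phi> *v w) - \<Phi> *v w = c - (\<Phi> *v w - trans_matrix K *v (\<Phi> *v w))" by simp
  then have "weighted_proj (occupancy K \<zeta>) (feature_space \<Phi>) (c + trans_matrix K *v (\<Phi> *v w)) = \<Phi> *v w \<longleftrightarrow>
      (\<forall>v. (feature_moment (occupancy K \<zeta>) \<Phi> c - lstd_limit_matrix K \<zeta> \<Phi> *v w) \<bullet> v = 0)"
    by (simp only: weighted_proj_eq_iff[OF q inj] weighted_inner_feature feature_moment_diff lstd_limit_matrix_moment)
  also have "\<dots> \<longleftrightarrow> lstd_limit_matrix K \<zeta> \<Phi> *v w = feature_moment (occupancy K \<zeta>) \<Phi> c"
    by (metis eq_iff_diff_eq_0 inner_eq_zero_iff inner_zero_left)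
  also have "\<dots> \<longleftrightarrow> w = matrix_inv (lstd_limit_matrix K \<zeta> \<Phi>) *v feature_moment (occupancy K \<zeta>) \<Phi> c"
    by (rule mult_matrix_inv_vector_eq_iff[OF lstd_limit_matrix_invertible[OF assms]])
  finally show ?thesis .
qed

text \<open>The estimate \<open>w\<close> inside \<open>lstd_d\<close> depends on all N
  trajectories, so for that \<open>w\<close> the summands are not independent. Splitting into a
  constant and a linear part in \<open>w\<close> leaves two sample means of fixed functions of one
  trajectory, to which the strong law applies.\<close>

definition lstd_d_const :: "real ^ 'n \<Rightarrow> real ^ 'm ^ 'n \<Rightarrow> 'n option \<Rightarrow> 'n option \<Rightarrow> real ^ 'm" where
  "lstd_d_const r \<Phi>\<^sub>M z z' = (reward r z * reward r z) *\<^sub>R feature \<Phi>\<^sub>M z"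

definition lstd_d_lin ::
  "real ^ 'n \<Rightarrow> real ^ 'j ^ 'n \<Rightarrow> real ^ 'm ^ 'n \<Rightarrow> 'n option \<Rightarrow> 'n option \<Rightarrow> real ^ 'j ^ 'm" where
  "lstd_d_lin r \<Phi>\<^sub>J \<Phi>\<^sub>M z z' = outer ((2 * reward r z) *\<^sub>R feature \<Phi>\<^sub>M z) (feature \<Phi>\<^sub>J z')"

lemma lstd_d_split:
  "(reward r z * (reward r z + 2 * (feature \<Phi>\<^sub>J z' \<bullet> w))) *\<^sub>R feature \<Phi>\<^sub>M z =
    lstd_d_const r \<Phi>\<^sub>M z z' + lstd_d_lin r \<Phi>\<^sub>J \<Phi>\<^sub>M z z' *v w"
  by (simp add: lstd_d_const_def lstd_d_lin_def outer_mult_vector algebra_simps)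

lemma lstd_d_affine:
  "lstd_d r \<Phi>\<^sub>J \<Phi>\<^sub>M w xs N = sample_mean (path_sum (lstd_d_const r \<Phi>\<^sub>M)) xs N +
    sample_mean (path_sum (lstd_d_lin r \<Phi>\<^sub>J \<Phi>\<^sub>M)) xs N *v w"
  unfolding linear_sample_mean_path_sum[OF linear_apply_matrix] sample_mean_path_sum_add[symmetric]
  by (simp add: lstd_d_def lstd_d_split path_sum_def[abs_def])

lemma lstd_b_limit:
  "transition_mean K \<zeta> (\<lambda>z z'. reward r z *\<^sub>R feature \<Phi> z) = feature_moment (occupancy K \<zeta>) \<Phi> r"
  by (simp add: transition_mean_feature sum_pmf_UNIV flip: sum_distrib_right)

lemma lstd_d_limit:
  "transition_mean K \<zeta> (lstd_d_const r \<Phi>\<^sub>M) + transition_mean K \<zeta> (lstd_d_lin r \<Phi>\<^sub>J \<Phi>\<^sub>M) *v w =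
    feature_moment (occupancy K \<zeta>) \<Phi>\<^sub>M
      (diag_matrix r *v r + 2 *\<^sub>R (diag_matrix r *v (trans_matrix K *v (\<Phi>\<^sub>J *v w))))"
proof -
  have diag: "(diag_matrix r *v u) $ a = r $ a * u $ a" for u a
    by (simp add: diag_matrix_def matrix_vector_mult_def if_distrib[of "\<lambda>x. x * _"] cong: if_cong)
  have const: "(\<Sum>z\<in>UNIV. s * (s * pmf (K a) z)) = s * s" for s a
    by (simp add: sum_pmf_UNIV flip: sum_distrib_left)
  show ?thesis
    unfolding linear_transition_mean[OF linear_apply_matrix] transition_mean_add[symmetric]
      lstd_d_split[symmetric] transition_mean_feature
    by (rule arg_cong[where f = "feature_moment _ _"])
       (simp add: vec_eq_iff diag trans_matrix_apply distrib_left sum.distrib const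
         sum_distrib_left mult_ac)
qed

section \<open>Unique target weights and convergence of the estimates\<close>

theorem theorem9:
  fixes K :: "'n::finite \<Rightarrow> 'n option pmf"
    and \<zeta>\<^sub>0 :: "'n pmf"
    and r :: "real ^ 'n"
    and \<Phi>\<^sub>J :: "real ^ 'j::finite ^ 'n"
    and \<Phi>\<^sub>M :: "real ^ 'm::finite ^ 'n"
    and M :: "'w measure"
    and X :: "nat \<Rightarrow> 'w \<Rightarrow> nat \<Rightarrow> 'n option"
    and A_inv :: "nat \<Rightarrow> 'w \<Rightarrow> real ^ 'j ^ 'j"
    and C_inv :: "nat \<Rightarrow> 'w \<Rightarrow> real ^ 'm ^ 'm"
    and w\<^sub>J :: "nat \<Rightarrow> 'w \<Rightarrow> real ^ 'j"
    and w\<^sub>M :: "nat \<Rightarrow> 'w \<Rightarrow> real ^ 'm"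
  assumes "proper K"
    and "rank \<Phi>\<^sub>J = CARD('j)"
    and "rank \<Phi>\<^sub>M = CARD('m)"
    and "\<And>x. occupancy K \<zeta>\<^sub>0 x > 0"
    and "prob_space M"
    and "iid_trajectories M K \<zeta>\<^sub>0 X"
    and "\<And>N \<omega>. is_inverse_choice (A_inv N \<omega>) (lstd_matrix \<Phi>\<^sub>J (\<lambda>k. X k \<omega>) N)"
    and "\<And>N \<omega>. is_inverse_choice (C_inv N \<omega>) (lstd_matrix \<Phi>\<^sub>M (\<lambda>k. X k \<omega>) N)"
    and "\<And>N \<omega>. w\<^sub>J N \<omega> = A_inv N \<omega> *v lstd_b r \<Phi>\<^sub>J (\<lambda>k. X k \<omega>) N"
    and "\<And>N \<omega>. w\<^sub>M N \<omega> = C_inv N \<omega> *v lstd_d r \<Phi>\<^sub>J \<Phi>\<^sub>M (w\<^sub>J N \<omega>) (\<lambda>k. X k \<omega>) N"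
  shows "(\<exists>!p. is_target K \<zeta>\<^sub>0 r \<Phi>\<^sub>J \<Phi>\<^sub>M p) \<and>
    (AE \<omega> in M. (\<lambda>N. w\<^sub>J N \<omega>) \<longlonglongrightarrow> fst (target_weights K \<zeta>\<^sub>0 r \<Phi>\<^sub>J \<Phi>\<^sub>M) \<and>
                (\<lambda>N. w\<^sub>M N \<omega>) \<longlonglongrightarrow> snd (target_weights K \<zeta>\<^sub>0 r \<Phi>\<^sub>J \<Phi>\<^sub>M))"
proof -
  interpret prob_space M by fact
  let ?q = "occupancy K \<zeta>\<^sub>0"
  let ?A = "lstd_limit_matrix K \<zeta>\<^sub>0 \<Phi>\<^sub>J" and ?C = "lstd_limit_matrix K \<zeta>\<^sub>0 \<Phi>\<^sub>M"
  define d where "d = (\<lambda>w. feature_moment ?q \<Phi>\<^sub>M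
    (diag_matrix r *v r + 2 *\<^sub>R (diag_matrix r *v (trans_matrix K *v (\<Phi>\<^sub>J *v w)))))"
  define wJ where "wJ = matrix_inv ?A *v feature_moment ?q \<Phi>\<^sub>J r"
  define wM where "wM = matrix_inv ?C *v d wJ"
  have inj: "inj ((*v) \<Phi>\<^sub>J)" "inj ((*v) \<Phi>\<^sub>M)"
    using assms(2,3) by (simp_all add: full_rank_injective)
  note inv = lstd_limit_matrix_invertible[OF assms(1,4) inj(1)] lstd_limit_matrix_invertible[OF assms(1,4) inj(2)]
  \<comment> \<open>The system is triangular: the first equation determines \<open>wJ\<close> alone,
    and inserting it makes the second an equation for the other weights only.\<close>
  have target: "is_target K \<zeta>\<^sub>0 r \<Phi>\<^sub>J \<Phi>\<^sub>M p \<longleftrightarrow> p = (wJ, wM)" for p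
    by (cases p)
       (auto simp: is_target_def Let_def projected_equation_iff[OF assms(1,4) inj(1)]
         projected_equation_iff[OF assms(1,4) inj(2)] wJ_def wM_def d_def)
  then have weights: "target_weights K \<zeta>\<^sub>0 r \<Phi>\<^sub>J \<Phi>\<^sub>M = (wJ, wM)"
    by (simp add: target_weights_def)
  note slln = strong_law_path_sum[OF assms(1,6)]
  have "AE \<omega> in M. lstd_matrix \<Phi>\<^sub>J (\<lambda>k. X k \<omega>) \<longlonglongrightarrow> ?A"
    using slln[of "\<lambda>z z'. outer (feature \<Phi>\<^sub>J z) (feature \<Phi>\<^sub>J z - feature \<Phi>\<^sub>J z')"]
    by (simp add: lstd_matrix_def lstd_limit_matrix_def path_sum_def[abs_def])
  moreover have "AE \<omega> in M. lstd_matrix \<Phi>\<^sub>M (\<lambda>k. X k \<omega>) \<longlonglongrightarrow> ?C"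
    using slln[of "\<lambda>z z'. outer (feature \<Phi>\<^sub>M z) (feature \<Phi>\<^sub>M z - feature \<Phi>\<^sub>M z')"]
    by (simp add: lstd_matrix_def lstd_limit_matrix_def path_sum_def[abs_def])
  moreover have "AE \<omega> in M. lstd_b r \<Phi>\<^sub>J (\<lambda>k. X k \<omega>) \<longlonglongrightarrow> feature_moment ?q \<Phi>\<^sub>J r"
    using slln[of "\<lambda>z z'. reward r z *\<^sub>R feature \<Phi>\<^sub>J z"]
    by (simp add: lstd_b_def lstd_b_limit path_sum_def[abs_def])
  moreover have "AE \<omega> in M. sample_mean (path_sum (lstd_d_const r \<Phi>\<^sub>M)) (\<lambda>k. X k \<omega>) \<longlonglongrightarrow>
      transition_mean K \<zeta>\<^sub>0 (lstd_d_const r \<Phi>\<^sub>M)"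
    by (rule slln) (simp add: lstd_d_const_def)
  moreover have "AE \<omega> in M. sample_mean (path_sum (lstd_d_lin r \<Phi>\<^sub>J \<Phi>\<^sub>M)) (\<lambda>k. X k \<omega>) \<longlonglongrightarrow>
      transition_mean K \<zeta>\<^sub>0 (lstd_d_lin r \<Phi>\<^sub>J \<Phi>\<^sub>M)"
    by (rule slln) (simp add: lstd_d_lin_def)
  \<comment> \<open>On the intersection of the five almost sure events the remaining argument is
    deterministic continuity.\<close>
  ultimately have "AE \<omega> in M. (\<lambda>N. w\<^sub>J N \<omega>) \<longlonglongrightarrow> wJ \<and> (\<lambda>N. w\<^sub>M N \<omega>) \<longlonglongrightarrow> wM"
  proof eventually_elim
    case (elim \<omega>)
    have J: "(\<lambda>N. w\<^sub>J N \<omega>) \<longlonglongrightarrow> wJ"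
      unfolding assms(9) wJ_def by (rule tendsto_inverse_choice_mult[OF elim(1,3) inv(1) assms(7)])
    \<comment> \<open>The first limit \<open>J\<close> enters here: \<open>lstd_d\<close> is affine
      in the estimate with convergent coefficients.\<close>
    have "(\<lambda>N. lstd_d r \<Phi>\<^sub>J \<Phi>\<^sub>M (w\<^sub>J N \<omega>) (\<lambda>k. X k \<omega>) N) \<longlonglongrightarrow> d wJ"
      unfolding d_def lstd_d_limit[symmetric] lstd_d_affine
      by (intro tendsto_add tendsto_matrix_vector_mult elim(4,5) J)
    then have "(\<lambda>N. w\<^sub>M N \<omega>) \<longlonglongrightarrow> wM"
      unfolding assms(10) wM_def by (rule tendsto_inverse_choice_mult[OF elim(2) _ inv(2) assms(8)])
    with J show ?case by blast
  qed
  then show ?thesis by (simp add: target weights)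
qed

end
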